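(* Let $\alpha=\frac23$ and let $V(x)=(v+f\vec n)/|x|^{2/3}$, $P(x)=p/|x|^{4/3}$ be a homogeneous solution of the stationary Euler equations $V\cdot\nabla V+\nabla P=0$, $\operatorname{div}V=0$ in $\mathbb{R}^3\setminus\{0\}$ with $v,f,p\in C^\infty(\mathbb{S}^2)$. Let $\bar V,\bar P,F$ be the tapered velocity field, pressure and force constructed from $(V,P)$ as described in the context, so that $$\bar V\cdot\nabla\bar V+\nabla\bar P=F,\qquad \operatorname{div}\bar V=0 ,$$ with $\bar V=V$ in the unit ball, $\bar V$ compactly supported, $\bar V\in L^2(\mathbb{R}^3)$, $F$ divergence-free, $F\in C^\infty_{\mathrm{loc}}(\mathbb{R}^3)$, and $|\nabla^kF(x)|\lesssim|x|^{-3-k}$ as $|x|\to\infty$ for all $k=0,1,2,\dots$. Then the energy flux vanishes: $$\Pi=\int_{\mathbb{R}^3}F\cdot\bar V\,dx=0.$$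
   Context: $\mathbb{S}^2$ is the unit sphere in $\mathbb{R}^3$ with outward unit normal $\vec n$; $v$ is a tangent vector field and $f,p$ are functions on $\mathbb{S}^2$, evaluated at $x/|x|$. Construction of $\bar V,\bar P,F$ (with $\alpha=\frac23$): Since $\alpha\neq2$, there is a stream-field $\Psi=|x|^{1-\alpha}(\psi+h\vec n)$ in $\mathbb{R}^3\setminus\{0\}$, with $\psi$ a smooth tangent field and $h$ a smooth function on $\mathbb{S}^2$, such that $V=\operatorname{curl}\Psi$ and $\operatorname{div}\Psi=0$. Let $\varphi(r)$ be smooth on $(0,\infty)$ with $\varphi(r)=r^{1-\alpha}$ for $r<1$ and $\varphi(r)=0$ for $r>2$; set $\bar\Psi=\varphi(|x|)(\psi+h\vec n)$ and $\bar V=\operatorname{curl}\bar\Psi$. Let $\tilde P=\chi(|x|)P$, where $\chi$ is smooth on $(0,\infty)$, $\chi=1$ for $r<1$ and $\chi=0$ for $r>2$. Thus $(\bar V,\tilde P)$ is supported in $\{|x|\le2\}$ and coincides with $(V,P)$ in the unit ball. Let $Q=-\Delta\tilde P-\operatorname{div}\operatorname{div}(\bar V\otimes\bar V)$ for $1\le|x|\le2$ and $Q=0$ otherwise, and let $P_0$ be the convolution of $Q$ with the Newtonian potential, so $\Delta P_0=Q$ on $\mathbb{R}^3$. Set $\bar P=\tilde P+P_0$ and let $F=\nabla P_0$ for $|x|<1$ and for $|x|>2$, and $F=\bar V\cdot\nabla\bar V+\nabla\bar P$ for $1\le|x|\le2$. *)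

theory Defs
  imports "HOL-Analysis.Analysis"
begin

text \<open>
  \<open>smooth_on S f\<close> is meant for open \<open>S\<close>.  On finite-dimensional spaces, continuity of all iterated
  directional derivatives is the usual \<open>C\<^sup>\<infinity>\<close> condition.
\<close>

primrec Ck_on :: "nat \<Rightarrow> 'a::real_normed_vector set \<Rightarrow> ('a \<Rightarrow> 'b::real_normed_vector) \<Rightarrow> bool" where
  "Ck_on 0 S f \<longleftrightarrow> continuous_on S f"
| "Ck_on (Suc k) S f \<longleftrightarrow>
     (\<forall>x\<in>S. f differentiable (at x)) \<and> (\<forall>u. Ck_on k S (\<lambda>x. frechet_derivative f (at x) u))"

definition smooth_on :: "'a::real_normed_vector set \<Rightarrow> ('a \<Rightarrow> 'b::real_normed_vector) \<Rightarrow> bool" where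
  "smooth_on S f \<longleftrightarrow> (\<forall>k. Ck_on k S f)"

text \<open>
  Functions on the unit sphere are total functions on the ambient space of which only the values on
  the sphere matter; smoothness is that of the embedded submanifold (local smooth extendability).
\<close>

definition smooth_on_sphere :: "(real^3 \<Rightarrow> 'b::real_normed_vector) \<Rightarrow> bool" where
  "smooth_on_sphere g \<longleftrightarrow>
     (\<forall>x\<in>sphere 0 1. \<exists>U G. open U \<and> x \<in> U \<and> smooth_on U G \<and> (\<forall>y\<in>U \<inter> sphere 0 1. G y = g y))"

definition tangent_to_sphere :: "(real^3 \<Rightarrow> real^3) \<Rightarrow> bool" where
  "tangent_to_sphere w \<longleftrightarrow> (\<forall>y\<in>sphere 0 1. w y \<bullet> y = 0)"

definition partial :: "3 \<Rightarrow> (real^3 \<Rightarrow> 'b::real_normed_vector) \<Rightarrow> real^3 \<Rightarrow> 'b" where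
  "partial i g x = frechet_derivative g (at x) (axis i 1)"

definition grad :: "(real^3 \<Rightarrow> real) \<Rightarrow> real^3 \<Rightarrow> real^3" where
  "grad g x = (\<chi> i. partial i g x)"

definition diverg :: "(real^3 \<Rightarrow> real^3) \<Rightarrow> real^3 \<Rightarrow> real" where
  "diverg W x = (\<Sum>i\<in>UNIV. partial i (\<lambda>y. W y $ i) x)"

definition curl :: "(real^3 \<Rightarrow> real^3) \<Rightarrow> real^3 \<Rightarrow> real^3" where
  "curl W x = vector
     [partial 2 (\<lambda>y. W y $ 3) x - partial 3 (\<lambda>y. W y $ 2) x,
      partial 3 (\<lambda>y. W y $ 1) x - partial 1 (\<lambda>y. W y $ 3) x,
      partial 1 (\<lambda>y. W y $ 2) x - partial 2 (\<lambda>y. W y $ 1) x]"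

definition laplacian :: "(real^3 \<Rightarrow> real) \<Rightarrow> real^3 \<Rightarrow> real" where
  "laplacian g x = (\<Sum>i\<in>UNIV. partial i (partial i g) x)"

text \<open>\<open>advect W\<close> is \<open>W \<cdot> \<nabla>W\<close>, and \<open>div_div_tensor W\<close> is \<open>div div (W \<otimes> W)\<close>.\<close>

definition advect :: "(real^3 \<Rightarrow> real^3) \<Rightarrow> real^3 \<Rightarrow> real^3" where
  "advect W x = (\<Sum>j\<in>UNIV. (W x $ j) *\<^sub>R partial j W x)"

definition div_div_tensor :: "(real^3 \<Rightarrow> real^3) \<Rightarrow> real^3 \<Rightarrow> real" where
  "div_div_tensor W x = (\<Sum>i\<in>UNIV. \<Sum>j\<in>UNIV. partial i (partial j (\<lambda>y. W y $ i * W y $ j)) x)"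

text \<open>
  \<open>g(|x|) (w + q n)\<close>, with \<open>w\<close>, \<open>q\<close> and the unit normal \<open>n\<close> of the sphere evaluated at
  \<open>sgn x = x/|x|\<close>, where \<open>n = sgn x\<close>.
\<close>

definition radial_field ::
  "(real \<Rightarrow> real) \<Rightarrow> (real^3 \<Rightarrow> real^3) \<Rightarrow> (real^3 \<Rightarrow> real) \<Rightarrow> real^3 \<Rightarrow> real^3" where
  "radial_field g w q x = g (norm x) *\<^sub>R (w (sgn x) + q (sgn x) *\<^sub>R sgn x)"

text \<open>The sign is the one for which the convolution \<open>P\<^sub>0\<close> with \<open>Q\<close> solves \<open>\<Delta>P\<^sub>0 = Q\<close>.\<close>

definition newtonian_potential :: "real^3 \<Rightarrow> real" where
  "newtonian_potential z = - 1 / (4 * pi * norm z)"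

definition newtonian_convolution :: "(real^3 \<Rightarrow> real) \<Rightarrow> real^3 \<Rightarrow> real" where
  "newtonian_convolution Q x = (LINT y|lborel. newtonian_potential (x - y) * Q y)"

definition pressure_source :: "(real^3 \<Rightarrow> real^3) \<Rightarrow> (real^3 \<Rightarrow> real) \<Rightarrow> real^3 \<Rightarrow> real" where
  "pressure_source W p x =
     (if 1 \<le> norm x \<and> norm x \<le> 2 then - laplacian p x - div_div_tensor W x else 0)"

end

theory Submission
  imports Defs
begin

text \<open>
  Let \<open>B = \<bar>V\<bar>\<^sup>2/2 + P\<close>.  Away from the origin \<open>F \<cdot> Vbar\<close> is the divergence of
  \<open>(\<bar>Vbar\<bar>\<^sup>2/2 + Pbar) Vbar\<close>, so the energy flux is the limit of the fluxes of \<open>(B + P\<^sub>0) V\<close> through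
  shrinking (smeared) spheres.  The part with \<open>P\<^sub>0\<close> tends to \<open>0\<close>, and since \<open>\<alpha> = 2/3\<close> the flux of
  \<open>B V\<close> is the same at all scales.  It vanishes because \<open>B\<close> is transported by \<open>V\<close>: the field
  \<open>B ln\<bar>B\<bar> V\<close> is divergence-free as well, so its flux is also the same at all scales, while by
  homogeneity rescaling changes that flux by a nonzero multiple of the flux of \<open>B V\<close>.
\<close>

section \<open>Calculus of \<open>C\<^sup>k\<close> functions\<close>

text \<open>The field \<open>B V\<close> is homogeneous of degree -4/3 - 2/3 = -2, exactly the
  degree at which the flux through a sphere cannot depend on its radius, so homogeneity alone gives
  no information. At any other degree it would: for s > 0 the flux of B |B|^s V is constant by
  transport but scales like r^(-4s/3), hence is zero. The logarithm is the derivative of this family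
  at the critical exponent s = 0. It is singular where \<open>B\<close> vanishes, which cannot be
  excluded, so it enters as ln (B^2 + \<delta>), and \<delta> tends to 0 only after two scales have
  been compared.

  Fluxes are volume integrals of the derivative of a cutoff along the field. They rest on two facts:
  a directional derivative of a compactly supported C^1 function has integral 0, and Lebesgue
  measure behaves in a known way under translation and scaling. The singular origin is cut out first
  and recovered by dominated convergence.\<close>

lemma frechet_derivative_cong_open:
  assumes "open S" "x \<in> S" "\<And>y. y \<in> S \<Longrightarrow> f y = g y"
  shows "frechet_derivative f (at x) = frechet_derivative g (at x)"
proof -
  \<comment> \<open>\<open>frechet_derivative\<close> is a choice among all derivatives at a point.
    Functions that agree near \<open>x\<close> have the same derivatives there, so the choices
    coincide even at a point where there are none.\<close>
  have "(f has_derivative f') (at x) \<longleftrightarrow> (g has_derivative f') (at x)" for f'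
    using has_derivative_transform_within_open[of f f' x UNIV S g]
      has_derivative_transform_within_open[of g f' x UNIV S f] assms by auto
  then show ?thesis by (simp add: frechet_derivative_def)
qed

lemma differentiable_cong_open:
  assumes "open S" "x \<in> S" "\<And>y. y \<in> S \<Longrightarrow> f y = g y" "f differentiable (at x)"
  shows "g differentiable (at x)"
  using assms has_derivative_transform_within_open[of f _ x UNIV S g]
  unfolding differentiable_def by blast

lemma Ck_on_cong:
  assumes "open S" "\<And>x. x \<in> S \<Longrightarrow> f x = g x"
  shows "Ck_on k S f \<longleftrightarrow> Ck_on k S g"
  using assms(2)
proof (induction k arbitrary: f g)
  case 0
  then show ?case by (simp cong: continuous_on_cong)
next
  case (Suc k)
  have "f differentiable (at x) \<longleftrightarrow> g differentiable (at x)" if "x \<in> S" for x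
    using differentiable_cong_open[OF assms(1) that, of f g]
      differentiable_cong_open[OF assms(1) that, of g f] Suc.prems by auto
  moreover have "Ck_on k S (\<lambda>x. frechet_derivative f (at x) u) \<longleftrightarrow>
      Ck_on k S (\<lambda>x. frechet_derivative g (at x) u)" for u
    by (rule Suc.IH) (simp add: frechet_derivative_cong_open[OF assms(1) _ Suc.prems])
  ultimately show ?case by simp
qed

text \<open>Derivatives are unique, and \<open>Ck_on\<close> on an open set depends only on values
  there, so any explicit formula may stand in for the choice made by
  \<open>frechet_derivative\<close>.\<close>

lemma Ck_on_SucI:
  assumes "open S" "\<And>x. x \<in> S \<Longrightarrow> (f has_derivative f' x) (at x)"
    "\<And>u. Ck_on k S (\<lambda>x. f' x u)"
  shows "Ck_on (Suc k) S f"
proof -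
  have "frechet_derivative f (at x) = f' x" if "x \<in> S" for x
    using assms(2)[OF that] frechet_derivative_at by metis
  then have "Ck_on k S (\<lambda>x. frechet_derivative f (at x) u)" for u
    by (subst Ck_on_cong[OF assms(1), where g = "\<lambda>x. f' x u"]) (simp_all add: assms(3))
  with assms(2) show ?thesis by (auto simp: differentiable_def)
qed

lemma Ck_on_Suc_has_derivative:
  assumes "Ck_on (Suc k) S f" "x \<in> S"
  shows "(f has_derivative frechet_derivative f (at x)) (at x)"
  using assms by (simp add: frechet_derivative_works)

lemma Ck_on_frechet_derivative:
  "Ck_on (Suc k) S f \<Longrightarrow> Ck_on k S (\<lambda>x. frechet_derivative f (at x) u)"
  by simp

lemma Ck_on_imp_continuous_on: "Ck_on k S f \<Longrightarrow> continuous_on S f"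
  by (cases k) (auto intro!: continuous_at_imp_continuous_on differentiable_imp_continuous_within)

lemma Ck_on_SucD: "Ck_on (Suc k) S f \<Longrightarrow> Ck_on k S f"
proof (induction k arbitrary: f)
  case 0
  then show ?case using Ck_on_imp_continuous_on[of "Suc 0"] by (metis Ck_on.simps(1))
next
  case (Suc k)
  then show ?case by simp
qed

lemma Ck_on_subset: "Ck_on k S f \<Longrightarrow> T \<subseteq> S \<Longrightarrow> Ck_on k T f"
  by (induction k arbitrary: f) (auto intro: continuous_on_subset)

lemma Ck_on_locally:
  assumes "\<And>x. x \<in> S \<Longrightarrow> \<exists>T. open T \<and> x \<in> T \<and> Ck_on k T f"
  shows "Ck_on k S f"
  using assms
proof (induction k arbitrary: f)
  case 0
  then show ?case
    by (metis Ck_on.simps(1) continuous_at_imp_continuous_on continuous_on_eq_continuous_at)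
next
  case (Suc k)
  have "Ck_on k S (\<lambda>x. frechet_derivative f (at x) u)" for u
    by (rule Suc.IH) (metis Suc.prems Ck_on_frechet_derivative)
  moreover have "f differentiable (at x)" if "x \<in> S" for x
    using Suc.prems[OF that] by auto
  ultimately show ?case by simp
qed

lemma Ck_on_Un:
  assumes "open S" "open T" "Ck_on k S f" "Ck_on k T f"
  shows "Ck_on k (S \<union> T) f"
  by (rule Ck_on_locally) (use assms in blast)

lemma Ck_on_const: "open S \<Longrightarrow> Ck_on k S (\<lambda>x. c)"
  by (induction k arbitrary: c) (auto intro!: Ck_on_SucI[where f' = "\<lambda>x u. 0"] simp del: Ck_on.simps(2))

lemma Ck_on_bounded_linear:
  assumes "open S" "bounded_linear f"
  shows "Ck_on k S f"
proof (cases k)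
  case 0
  then show ?thesis using assms by (simp add: linear_continuous_on)
next
  case (Suc j)
  show ?thesis unfolding Suc
    by (rule Ck_on_SucI[where f' = "\<lambda>x. f"])
      (use assms in \<open>auto intro: bounded_linear_imp_has_derivative Ck_on_const\<close>)
qed

lemma Ck_on_add:
  assumes "open S" "Ck_on k S f" "Ck_on k S g"
  shows "Ck_on k S (\<lambda>x. f x + g x)"
  using assms(2,3)
proof (induction k arbitrary: f g)
  case 0
  then show ?case by (simp add: continuous_on_add)
next
  case (Suc k)
  show ?case
    by (rule Ck_on_SucI[OF assms(1) has_derivative_add[OF Ck_on_Suc_has_derivative[OF Suc.prems(1)]
            Ck_on_Suc_has_derivative[OF Suc.prems(2)]]])
      (assumption | intro Suc.IH Ck_on_frechet_derivative Suc.prems)+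
qed

lemma (in bounded_bilinear) Ck_on_prod:
  assumes "open S" "Ck_on k S f" "Ck_on k S g"
  shows "Ck_on k S (\<lambda>x. prod (f x) (g x))"
  using assms(2,3)
proof (induction k arbitrary: f g)
  case 0
  then show ?case by (simp add: continuous_on)
next
  case (Suc k)
  show ?case
    by (rule Ck_on_SucI[OF assms(1) FDERIV[OF Ck_on_Suc_has_derivative[OF Suc.prems(1)]
            Ck_on_Suc_has_derivative[OF Suc.prems(2)]]])
      (assumption | intro Ck_on_add[OF assms(1)] Suc.IH Ck_on_frechet_derivative Suc.prems
        Ck_on_SucD[OF Suc.prems(1)]
        Ck_on_SucD[OF Suc.prems(2)])+
qed

lemmas Ck_on_mult = bounded_bilinear.Ck_on_prod[OF bounded_bilinear_mult]
lemmas Ck_on_scaleR = bounded_bilinear.Ck_on_prod[OF bounded_bilinear_scaleR]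
lemmas Ck_on_inner = bounded_bilinear.Ck_on_prod[OF bounded_bilinear_inner]

lemma Ck_on_linear_image:
  assumes "open S" "bounded_linear L" "Ck_on k S f"
  shows "Ck_on k S (\<lambda>x. L (f x))"
  using assms(3)
proof (induction k arbitrary: f)
  case 0
  then show ?case using assms(2) by (simp add: bounded_linear.continuous_on)
next
  case (Suc k)
  show ?case
    by (rule Ck_on_SucI[OF assms(1) bounded_linear.has_derivative[OF assms(2)
            Ck_on_Suc_has_derivative[OF Suc.prems]]])
      (assumption | intro Suc.IH Ck_on_frechet_derivative Suc.prems)+
qed

lemmas Ck_on_vec_nth = Ck_on_linear_image[OF _ bounded_linear_vec_nth]
lemmas Ck_on_uminus = Ck_on_linear_image[OF _ bounded_linear_minus[OF bounded_linear_ident]]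

lemma Ck_on_diff:
  assumes "open S" "Ck_on k S f" "Ck_on k S g"
  shows "Ck_on k S (\<lambda>x. f x - g x)"
  using Ck_on_add[OF assms(1,2) Ck_on_uminus[OF assms(1,3)]] by simp

lemma Ck_on_sum:
  assumes "open S" "\<And>i. i \<in> I \<Longrightarrow> Ck_on k S (f i)"
  shows "Ck_on k S (\<lambda>x. \<Sum>i\<in>I. f i x)"
  using assms(2)
  by (induction I rule: infinite_finite_induct) (auto intro: Ck_on_const Ck_on_add assms(1))

text \<open>The chain rule yields \<open>f' (g x) (g' x u)\<close>, whose direction moves with
  \<open>x\<close>, whereas \<open>Ck_on\<close> controls fixed directions only. Expanding the
  direction in \<open>Basis\<close> turns it into a sum of products to which the induction
  hypothesis applies.\<close>

lemma Ck_on_compose: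
  fixes g :: "'a::real_normed_vector \<Rightarrow> 'b::euclidean_space"
  assumes "open S" "open T" "g ` S \<subseteq> T" "Ck_on k T f" "Ck_on k S g"
  shows "Ck_on k S (\<lambda>x. f (g x))"
  using assms(4,5)
proof (induction k arbitrary: f)
  case 0
  then show ?case using assms(3) by (auto intro: continuous_on_compose2)
next
  case (Suc k)
  let ?f' = "\<lambda>y. frechet_derivative f (at y)" and ?g' = "\<lambda>x. frechet_derivative g (at x)"
  have chain: "((\<lambda>x. f (g x)) has_derivative
      (\<lambda>u. \<Sum>i\<in>Basis. (?g' x u \<bullet> i) *\<^sub>R ?f' (g x) i)) (at x)" if x: "x \<in> S" for x
  proof -
    have f: "(f has_derivative ?f' (g x)) (at (g x))"
      using Ck_on_Suc_has_derivative[OF Suc.prems(1)] x assms(3) by blast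
    then have lin: "linear (?f' (g x))" by (simp add: bounded_linear.linear has_derivative_bounded_linear)
    have expand: "?f' (g x) y = (\<Sum>i\<in>Basis. (y \<bullet> i) *\<^sub>R ?f' (g x) i)" for y
    proof -
      have "?f' (g x) y = ?f' (g x) (\<Sum>i\<in>Basis. (y \<bullet> i) *\<^sub>R i)"
        by (simp only: euclidean_representation)
      then show ?thesis by (simp only: linear_sum[OF lin] linear_cmul[OF lin] o_def)
    qed
    have "((\<lambda>x. f (g x)) has_derivative (\<lambda>u. ?f' (g x) (?g' x u))) (at x)"
      by (rule has_derivative_compose[OF Ck_on_Suc_has_derivative[OF Suc.prems(2) x] f])
    then show ?thesis by (subst (asm) expand)
  qed
  show ?case
    by (rule Ck_on_SucI[OF assms(1) chain])
      (assumption | intro Ck_on_sum Ck_on_scaleR Ck_on_inner Ck_on_const[OF assms(1)] Suc.IH assms(1)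
        Ck_on_frechet_derivative Suc.prems Ck_on_SucD[OF Suc.prems(2)])+
qed

lemma Ck_on_powr: "Ck_on k {0<..} (\<lambda>r::real. r powr a)"
proof (induction k arbitrary: a)
  case 0
  have "continuous_on {0<..} (\<lambda>r::real. r powr a)"
    by (rule continuous_on_powr) auto
  then show ?case by simp
next
  case (Suc k)
  show ?case
    by (rule Ck_on_SucI[where f' = "\<lambda>r u. a * r powr (a - 1) * u"])
      (auto intro!: Ck_on_mult Ck_on_const Suc has_real_derivative_powr[unfolded has_field_derivative_def])
qed

lemma Ck_on_norm:
  fixes S :: "'a::real_inner set"
  assumes "open S" "0 \<notin> S"
  shows "Ck_on k S norm"
proof -
  have "Ck_on k S (\<lambda>x. (x \<bullet> x) powr (1/2))"
  proof (rule Ck_on_compose[where T = "{0<..}" and f = "\<lambda>r. r powr (1/2)"])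
    show "Ck_on k S (\<lambda>x. x \<bullet> x)"
      by (intro Ck_on_inner Ck_on_bounded_linear bounded_linear_ident assms)
  qed (use assms in \<open>auto intro: Ck_on_powr\<close>)
  also have "(\<lambda>x. (x \<bullet> x) powr (1/2)) = (norm :: 'a \<Rightarrow> real)"
    by (simp add: norm_eq_sqrt_inner powr_half_sqrt fun_eq_iff)
  finally show ?thesis .
qed

lemma Ck_on_radial:
  fixes S :: "'a::real_inner set"
  assumes "open S" "0 \<notin> S" "Ck_on k {0<..} g"
  shows "Ck_on k S (\<lambda>x. g (norm x))"
  by (rule Ck_on_compose[where T = "{0<..}"]) (use assms Ck_on_norm in auto)

lemma Ck_on_sgn:
  fixes S :: "'a::real_inner set"
  assumes "open S" "0 \<notin> S"
  shows "Ck_on k S sgn"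
proof -
  have "Ck_on k S (\<lambda>x. (norm x powr (-1)) *\<^sub>R x)"
    using assms by (intro Ck_on_scaleR Ck_on_radial Ck_on_powr Ck_on_bounded_linear bounded_linear_ident)
  moreover have "(norm x powr (-1)) *\<^sub>R x = sgn x" for x :: 'a
    by (cases "x = 0") (simp_all add: sgn_div_norm powr_minus_divide divide_inverse)
  ultimately show ?thesis by simp
qed

section \<open>Closure properties of smooth functions\<close>

lemma smooth_on_frechet_derivative:
  "smooth_on S f \<Longrightarrow> smooth_on S (\<lambda>x. frechet_derivative f (at x) u)"
  unfolding smooth_on_def by (metis Ck_on.simps(2))

lemma smooth_on_has_derivative:
  "smooth_on S f \<Longrightarrow> x \<in> S \<Longrightarrow> (f has_derivative frechet_derivative f (at x)) (at x)"
  unfolding smooth_on_def by (metis Ck_on_Suc_has_derivative)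

lemma smooth_on_cong:
  "open S \<Longrightarrow> (\<And>x. x \<in> S \<Longrightarrow> f x = g x) \<Longrightarrow> smooth_on S f \<longleftrightarrow> smooth_on S g"
  unfolding smooth_on_def using Ck_on_cong by metis

lemma smooth_on_Un:
  "open S \<Longrightarrow> open T \<Longrightarrow> smooth_on S f \<Longrightarrow> smooth_on T f \<Longrightarrow> smooth_on (S \<union> T) f"
  unfolding smooth_on_def using Ck_on_Un by blast

lemma smooth_on_subset: "smooth_on S f \<Longrightarrow> T \<subseteq> S \<Longrightarrow> smooth_on T f"
  unfolding smooth_on_def using Ck_on_subset by blast

lemma smooth_on_const: "open S \<Longrightarrow> smooth_on S (\<lambda>x. c)"
  by (simp add: smooth_on_def Ck_on_const)

lemma smooth_on_add:
  "open S \<Longrightarrow> smooth_on S f \<Longrightarrow> smooth_on S g \<Longrightarrow> smooth_on S (\<lambda>x. f x + g x)"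
  by (simp add: smooth_on_def Ck_on_add)

lemma smooth_on_diff:
  "open S \<Longrightarrow> smooth_on S f \<Longrightarrow> smooth_on S g \<Longrightarrow> smooth_on S (\<lambda>x. f x - g x)"
  by (simp add: smooth_on_def Ck_on_diff)

lemma smooth_on_uminus: "open S \<Longrightarrow> smooth_on S f \<Longrightarrow> smooth_on S (\<lambda>x. - f x)"
  by (simp add: smooth_on_def Ck_on_uminus)

lemma smooth_on_sum:
  "open S \<Longrightarrow> (\<And>i. i \<in> I \<Longrightarrow> smooth_on S (f i)) \<Longrightarrow> smooth_on S (\<lambda>x. \<Sum>i\<in>I. f i x)"
  by (simp add: smooth_on_def Ck_on_sum)

lemma smooth_on_mult:
  fixes f g :: "_ \<Rightarrow> 'b::real_normed_algebra"
  shows "open S \<Longrightarrow> smooth_on S f \<Longrightarrow> smooth_on S g \<Longrightarrow> smooth_on S (\<lambda>x. f x * g x)"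
  by (simp add: smooth_on_def Ck_on_mult)

lemma smooth_on_scaleR:
  "open S \<Longrightarrow> smooth_on S f \<Longrightarrow> smooth_on S g \<Longrightarrow> smooth_on S (\<lambda>x. f x *\<^sub>R g x)"
  by (simp add: smooth_on_def Ck_on_scaleR)

lemma smooth_on_inner:
  "open S \<Longrightarrow> smooth_on S f \<Longrightarrow> smooth_on S g \<Longrightarrow> smooth_on S (\<lambda>x. f x \<bullet> g x)"
  by (simp add: smooth_on_def Ck_on_inner)

lemma smooth_on_vec_nth:
  "open S \<Longrightarrow> smooth_on S f \<Longrightarrow> smooth_on S (\<lambda>x. f x $ i)"
  by (simp add: smooth_on_def Ck_on_vec_nth)

lemma smooth_on_partial: "smooth_on S f \<Longrightarrow> smooth_on S (partial i f)"
  unfolding partial_def by (rule smooth_on_frechet_derivative)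

section \<open>Vector calculus on open sets\<close>

lemma has_real_derivative_along_line:
  fixes f :: "'a::real_normed_vector \<Rightarrow> real"
  assumes "(f has_derivative f') (at (c + s *\<^sub>R u))"
  shows "((\<lambda>s. f (c + s *\<^sub>R u)) has_real_derivative f' u) (at s)"
proof -
  have "((\<lambda>s. c + s *\<^sub>R u) has_derivative (\<lambda>h. h *\<^sub>R u)) (at s)"
    by (auto intro!: derivative_eq_intros)
  from has_derivative_compose[OF this assms]
  have "((\<lambda>s. f (c + s *\<^sub>R u)) has_derivative (\<lambda>h. f' (h *\<^sub>R u))) (at s)" .
  moreover have "(\<lambda>h. f' (h *\<^sub>R u)) = (*) (f' u)"
    using linear_cmul[OF bounded_linear.linear[OF has_derivative_bounded_linear[OF assms]]]
    by (simp add: fun_eq_iff mult.commute)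
  ultimately show ?thesis by (simp add: has_field_derivative_def)
qed

text \<open>The mean value theorem is applied in direction \<open>u\<close> to the increment of
  \<open>f\<close> along \<open>v\<close>, and then along \<open>v\<close> to the derivative in
  direction \<open>u\<close>. The second difference is symmetric in \<open>u\<close> and
  \<open>v\<close>, so it equally represents the mixed derivative taken in the other order.\<close>

lemma second_difference_mean_value:
  fixes f :: "'a::real_normed_vector \<Rightarrow> real"
  assumes "Ck_on 2 S f" and t: "0 < t"
    and S: "\<And>a b. 0 \<le> a \<Longrightarrow> a \<le> t \<Longrightarrow> 0 \<le> b \<Longrightarrow> b \<le> t \<Longrightarrow> x + a *\<^sub>R u + b *\<^sub>R v \<in> S"
  obtains a b where "0 \<le> a" "a \<le> t" "0 \<le> b" "b \<le> t"
    "f (x + t *\<^sub>R u + t *\<^sub>R v) - f (x + t *\<^sub>R u) - f (x + t *\<^sub>R v) + f x =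
      t\<^sup>2 * frechet_derivative (\<lambda>y. frechet_derivative f (at y) u) (at (x + a *\<^sub>R u + b *\<^sub>R v)) v"
proof -
  have f: "Ck_on (Suc (Suc 0)) S f" using assms(1) by (simp add: numeral_2_eq_2)
  let ?D = "\<lambda>y. frechet_derivative f (at y) u"
  let ?g = "\<lambda>s. f (x + t *\<^sub>R v + s *\<^sub>R u) - f (x + s *\<^sub>R u)"
  have inS: "x + t *\<^sub>R v + s *\<^sub>R u \<in> S" "x + s *\<^sub>R u \<in> S" if "0 \<le> s" "s \<le> t" for s
    using S[of s t] S[of s 0] t that by (auto simp: algebra_simps)
  have "\<exists>a. 0 < a \<and> a < t \<and> ?g t - ?g 0 = (t - 0) * (?D (x + t *\<^sub>R v + a *\<^sub>R u) - ?D (x + a *\<^sub>R u))"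
    by (rule MVT2[OF t], intro DERIV_diff has_real_derivative_along_line Ck_on_Suc_has_derivative[OF f] inS)
  then obtain a where a: "0 < a" "a < t"
    and ga: "?g t - ?g 0 = t * (?D (x + t *\<^sub>R v + a *\<^sub>R u) - ?D (x + a *\<^sub>R u))" by auto
  have "\<exists>b. 0 < b \<and> b < t \<and> ?D (x + a *\<^sub>R u + t *\<^sub>R v) - ?D (x + a *\<^sub>R u + 0 *\<^sub>R v) =
      (t - 0) * frechet_derivative ?D (at (x + a *\<^sub>R u + b *\<^sub>R v)) v"
    by (rule MVT2[OF t], intro has_real_derivative_along_line
          Ck_on_Suc_has_derivative[OF Ck_on_frechet_derivative[OF f]] S) (use a in auto)
  then obtain b where b: "0 < b" "b < t"
    and gb: "?D (x + a *\<^sub>R u + t *\<^sub>R v) - ?D (x + a *\<^sub>R u) =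
      t * frechet_derivative ?D (at (x + a *\<^sub>R u + b *\<^sub>R v)) v" by auto
  have "?g t - ?g 0 = t * (?D (x + a *\<^sub>R u + t *\<^sub>R v) - ?D (x + a *\<^sub>R u))"
    unfolding ga by (simp add: algebra_simps)
  then show ?thesis
    unfolding gb by (intro that[of a b]) (use a b in \<open>auto simp: power2_eq_square algebra_simps\<close>)
qed

lemma frechet_derivative_commute:
  fixes f :: "'a::real_normed_vector \<Rightarrow> real"
  assumes "open S" "x \<in> S" "Ck_on 2 S f"
  shows "frechet_derivative (\<lambda>y. frechet_derivative f (at y) u) (at x) v =
    frechet_derivative (\<lambda>y. frechet_derivative f (at y) v) (at x) u"
proof -
  let ?D = "\<lambda>u v y. frechet_derivative (\<lambda>y. frechet_derivative f (at y) u) (at y) v"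
  have cont: "continuous_on S (?D u v)" for u v
    using assms(3) by (simp add: numeral_2_eq_2)
  have "\<bar>?D u v x - ?D v u x\<bar> \<le> e" if "e > 0" for e
  proof -
    have near: "\<exists>d>0. ball x d \<subseteq> S \<and> (\<forall>y\<in>ball x d. \<bar>?D u v y - ?D u v x\<bar> < e / 2)" for u v
    proof -
      obtain d1 where d1: "d1 > 0" "ball x d1 \<subseteq> S" using assms(1,2) open_contains_ball by blast
      have "isCont (?D u v) x" using cont[of u v] assms(1,2) by (simp add: continuous_on_eq_continuous_at)
      then obtain d2 where d2: "d2 > 0" "\<And>y. dist y x < d2 \<Longrightarrow> dist (?D u v y) (?D u v x) < e / 2"
        unfolding continuous_at_eps_delta using \<open>e > 0\<close> half_gt_zero by blast
      show ?thesis using d1 d2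
        by (intro exI[of _ "min d1 d2"]) (auto simp: dist_commute dist_real_def)
    qed
    obtain d1 where d1: "d1 > 0" "ball x d1 \<subseteq> S" "\<And>y. y \<in> ball x d1 \<Longrightarrow> \<bar>?D u v y - ?D u v x\<bar> < e / 2"
      using near[of u v] by blast
    obtain d2 where d2: "d2 > 0" "\<And>y. y \<in> ball x d2 \<Longrightarrow> \<bar>?D v u y - ?D v u x\<bar> < e / 2"
      using near[of v u] by blast
    define d where "d = min d1 d2"
    define n where "n = norm u + norm v + 1"
    \<comment> \<open>The parallelogram spanned by \<open>t u\<close> and \<open>t v\<close> then
      stays within \<open>d / 2\<close> of \<open>x\<close>. The summand 1 keeps \<open>n\<close>
      positive when both directions are 0.\<close>
    define t where "t = d / n / 2"
    have pos: "n > 0" by (simp add: n_def add_nonneg_pos)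
    have d: "d > 0" using d1 d2 by (simp add: d_def)
    have t: "t > 0" using d pos by (simp add: t_def)
    have small: "x + a *\<^sub>R u + b *\<^sub>R v \<in> ball x d" if "0 \<le> a" "a \<le> t" "0 \<le> b" "b \<le> t" for a b
    proof -
      have "norm (a *\<^sub>R u + b *\<^sub>R v) \<le> a * norm u + b * norm v"
        using norm_triangle_ineq[of "a *\<^sub>R u" "b *\<^sub>R v"] that by simp
      also have "\<dots> \<le> t * norm u + t * norm v" using that by (intro add_mono mult_right_mono) auto
      also have "\<dots> \<le> t * n" using t by (simp add: n_def algebra_simps)
      also have "\<dots> = d / 2" using pos by (simp add: t_def)
      also have "\<dots> < d" using d by simp
      finally have "norm (a *\<^sub>R u + b *\<^sub>R v) < d" .
      moreover have "dist x (x + a *\<^sub>R u + b *\<^sub>R v) = norm (a *\<^sub>R u + b *\<^sub>R v)"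
        by (metis add.assoc add_diff_cancel_left' dist_commute dist_norm)
      ultimately show ?thesis by simp
    qed
    have inS: "x + a *\<^sub>R u + b *\<^sub>R v \<in> S" if "0 \<le> a" "a \<le> t" "0 \<le> b" "b \<le> t" for a b
      using small[OF that] d1(2) by (auto simp: d_def)
    have inS': "x + a *\<^sub>R v + b *\<^sub>R u \<in> S" if "0 \<le> a" "a \<le> t" "0 \<le> b" "b \<le> t" for a b
      using inS[OF that(3,4,1,2)] by (simp only: add.assoc add.commute[of "a *\<^sub>R v"])
    obtain a b where ab: "0 \<le> a" "a \<le> t" "0 \<le> b" "b \<le> t"
      "f (x + t *\<^sub>R u + t *\<^sub>R v) - f (x + t *\<^sub>R u) - f (x + t *\<^sub>R v) + f x =
        t\<^sup>2 * ?D u v (x + a *\<^sub>R u + b *\<^sub>R v)"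
      by (rule second_difference_mean_value[OF assms(3) t inS])
    obtain a' b' where ab': "0 \<le> a'" "a' \<le> t" "0 \<le> b'" "b' \<le> t"
      "f (x + t *\<^sub>R v + t *\<^sub>R u) - f (x + t *\<^sub>R v) - f (x + t *\<^sub>R u) + f x =
        t\<^sup>2 * ?D v u (x + a' *\<^sub>R v + b' *\<^sub>R u)"
      by (rule second_difference_mean_value[OF assms(3) t inS'])
    have "t\<^sup>2 * ?D u v (x + a *\<^sub>R u + b *\<^sub>R v) = t\<^sup>2 * ?D v u (x + a' *\<^sub>R v + b' *\<^sub>R u)"
      using ab(5) ab'(5) by (simp add: algebra_simps)
    then have "?D u v (x + a *\<^sub>R u + b *\<^sub>R v) = ?D v u (x + a' *\<^sub>R v + b' *\<^sub>R u)" using t by simp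
    moreover have "\<bar>?D u v (x + a *\<^sub>R u + b *\<^sub>R v) - ?D u v x\<bar> < e / 2"
      using small[OF ab(1-4)] by (intro d1(3)) (simp add: d_def)
    moreover have "x + a' *\<^sub>R v + b' *\<^sub>R u \<in> ball x d2"
      using small[OF ab'(3,4,1,2)] by (simp add: d_def algebra_simps)
    then have "\<bar>?D v u (x + a' *\<^sub>R v + b' *\<^sub>R u) - ?D v u x\<bar> < e / 2" by (rule d2(2))
    ultimately show ?thesis by linarith
  qed
  then have "\<bar>?D u v x - ?D v u x\<bar> \<le> 0" by (meson dense_ge)
  then show ?thesis by simp
qed

text \<open>A local extension \<open>G\<close> agrees with \<open>g\<close> only on the sphere, but
  \<open>sgn\<close> takes its values there, so \<open>G\<close> and \<open>g\<close> become equal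
  on an open set after composition with \<open>sgn\<close>.\<close>

lemma smooth_on_sphere_sgn:
  assumes "smooth_on_sphere g"
  shows "smooth_on (- {0}) (\<lambda>x. g (sgn x))"
proof -
  have "Ck_on k (- {0}) (\<lambda>x. g (sgn x))" for k
  proof (rule Ck_on_locally)
    fix x :: "real^3" assume "x \<in> - {0}"
    then have "sgn x \<in> sphere 0 1" by (simp add: norm_sgn)
    then obtain U G where U: "open U" "sgn x \<in> U" "smooth_on U G"
      and G: "\<forall>y\<in>U \<inter> sphere 0 1. G y = g y"
      using assms unfolding smooth_on_sphere_def by meson
    define T where "T = {y. y \<in> - {0} \<and> sgn y \<in> U}"
    have cont: "continuous_on (- {0 :: real^3}) sgn"
      by (rule Ck_on_imp_continuous_on[OF Ck_on_sgn]) auto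
    have T: "open T"
      using continuous_open_preimage[OF cont open_Compl[OF closed_singleton] U(1)]
      by (simp add: T_def vimage_def Int_def)
    have sub: "sgn ` T \<subseteq> U" "0 \<notin> T" by (auto simp: T_def)
    have "Ck_on k T (\<lambda>y. G (sgn y))"
      using Ck_on_compose[OF T U(1) sub(1) _ Ck_on_sgn[OF T sub(2)]] U(3) unfolding smooth_on_def by blast
    then have "Ck_on k T (\<lambda>y. g (sgn y))"
      by (subst Ck_on_cong[OF T, where g = "\<lambda>y. G (sgn y)"]) (use G in \<open>auto simp: T_def norm_sgn\<close>)
    then show "\<exists>T. open T \<and> x \<in> T \<and> Ck_on k T (\<lambda>x. g (sgn x))"
      using T U(2) \<open>x \<in> - {0}\<close> by (auto simp: T_def)
  qed
  then show ?thesis by (simp add: smooth_on_def)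
qed

lemma smooth_on_radial:
  fixes g :: "real \<Rightarrow> real"
  shows "smooth_on {0<..} g \<Longrightarrow> smooth_on (- {0}) (\<lambda>x :: real^3. g (norm x))"
  by (simp add: smooth_on_def Ck_on_radial open_Compl)

lemma smooth_on_sgn: "smooth_on (- {0}) (sgn :: real^3 \<Rightarrow> real^3)"
  by (simp add: smooth_on_def Ck_on_sgn open_Compl)

lemma smooth_on_powr: "smooth_on {0<..} (\<lambda>r::real. r powr a)"
  by (simp add: smooth_on_def Ck_on_powr)

lemma smooth_on_radial_field:
  assumes "smooth_on {0<..} g" "smooth_on_sphere w" "smooth_on_sphere q"
  shows "smooth_on (- {0}) (radial_field g w q)"
  unfolding radial_field_def using assms
  by (intro smooth_on_scaleR smooth_on_add smooth_on_radial smooth_on_sphere_sgn smooth_on_sgn) auto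

section \<open>Partial derivatives and the differential operators built from them\<close>

lemma partial_cong_open:
  assumes "open S" "x \<in> S" "\<And>y. y \<in> S \<Longrightarrow> f y = g y"
  shows "partial i f x = partial i g x"
  by (simp add: partial_def frechet_derivative_cong_open[OF assms])

lemma partial_eqI: "(f has_derivative f') (at x) \<Longrightarrow> partial i f x = f' (axis i 1)"
  unfolding partial_def by (metis frechet_derivative_at)

lemma partial_add:
  "smooth_on S f \<Longrightarrow> smooth_on S g \<Longrightarrow> x \<in> S \<Longrightarrow>
    partial i (\<lambda>y. f y + g y) x = partial i f x + partial i g x"
  by (subst partial_eqI[OF has_derivative_add[OF smooth_on_has_derivative smooth_on_has_derivative]])
    (auto simp: partial_def)

lemma partial_diff:
  "smooth_on S f \<Longrightarrow> smooth_on S g \<Longrightarrow> x \<in> S \<Longrightarrow>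
    partial i (\<lambda>y. f y - g y) x = partial i f x - partial i g x"
  by (subst partial_eqI[OF has_derivative_diff[OF smooth_on_has_derivative smooth_on_has_derivative]])
    (auto simp: partial_def)

lemma partial_mult:
  fixes f g :: "real^3 \<Rightarrow> real"
  shows "smooth_on S f \<Longrightarrow> smooth_on S g \<Longrightarrow> x \<in> S \<Longrightarrow>
    partial i (\<lambda>y. f y * g y) x = f x * partial i g x + partial i f x * g x"
  by (subst partial_eqI[OF has_derivative_mult[OF smooth_on_has_derivative smooth_on_has_derivative]])
    (auto simp: partial_def)

lemma partial_sum:
  "(\<And>j. j \<in> J \<Longrightarrow> smooth_on S (f j)) \<Longrightarrow> x \<in> S \<Longrightarrow>
    partial i (\<lambda>y. \<Sum>j\<in>J. f j y) x = (\<Sum>j\<in>J. partial i (f j) x)"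
  by (subst partial_eqI[OF has_derivative_sum[OF smooth_on_has_derivative]])
    (auto simp: partial_def)

lemma partial_vec_nth:
  "f differentiable (at x) \<Longrightarrow> partial i (\<lambda>y. f y $ j) x = partial i f x $ j"
  by (subst partial_eqI[OF bounded_linear.has_derivative[OF bounded_linear_vec_nth
          frechet_derivative_works[THEN iffD1]]]) (auto simp: partial_def)

lemma partial_commute:
  fixes f :: "real^3 \<Rightarrow> real"
  assumes "open S" "x \<in> S" "smooth_on S f"
  shows "partial i (partial j f) x = partial j (partial i f) x"
  unfolding partial_def
  by (rule frechet_derivative_commute[OF assms(1,2)]) (use assms(3) in \<open>simp add: smooth_on_def\<close>)

lemma vec_linear_expand:
  fixes L :: "real^3 \<Rightarrow> 'b::real_vector"
  assumes "linear L"
  shows "(\<Sum>i\<in>UNIV. (w $ i) *\<^sub>R L (axis i 1)) = L w"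
proof -
  have "L w = L (\<Sum>i\<in>UNIV. (w $ i) *\<^sub>R axis i 1)"
    using basis_expansion[of w] by (simp add: scalar_mult_eq_scaleR)
  then show ?thesis by (simp add: linear_sum[OF assms] linear_cmul[OF assms] o_def)
qed

lemma grad_inner:
  assumes "g differentiable (at x)"
  shows "grad g x \<bullet> w = frechet_derivative g (at x) w"
  using vec_linear_expand[OF linear_frechet_derivative[OF assms], of w]
  by (simp add: grad_def partial_def inner_vec_def mult.commute)

lemma advect_eq_frechet_derivative:
  assumes "W differentiable (at x)"
  shows "advect W x = frechet_derivative W (at x) (W x)"
  using vec_linear_expand[OF linear_frechet_derivative[OF assms], of "W x"]
  by (simp add: advect_def partial_def)

lemma smooth_on_vecI:
  fixes W :: "'a::real_normed_vector \<Rightarrow> real^3"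
  assumes "open S" "\<And>i. smooth_on S (\<lambda>x. W x $ i)"
  shows "smooth_on S W"
proof -
  have "smooth_on S (\<lambda>x. \<Sum>i\<in>UNIV. (W x $ i) *\<^sub>R axis i (1 :: real))"
    by (intro smooth_on_sum smooth_on_scaleR smooth_on_const assms)
  then show ?thesis by (simp only: scalar_mult_eq_scaleR[symmetric] basis_expansion)
qed

lemma smooth_on_curl:
  assumes "open S" "smooth_on S W"
  shows "smooth_on S (curl W)"
proof (rule smooth_on_vecI[OF assms(1)])
  fix i :: 3
  show "smooth_on S (\<lambda>x. curl W x $ i)"
    using exhaust_3[of i] unfolding curl_def
    by (elim disjE) (simp_all add: vector_3, (intro smooth_on_diff smooth_on_partial smooth_on_vec_nth assms)+)
qed

lemma smooth_on_advect: "open S \<Longrightarrow> smooth_on S W \<Longrightarrow> smooth_on S (advect W)"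
  unfolding advect_def by (intro smooth_on_sum smooth_on_scaleR smooth_on_partial smooth_on_vec_nth)

lemma smooth_on_grad:
  assumes "open S" "smooth_on S g"
  shows "smooth_on S (grad g)"
  by (rule smooth_on_vecI[OF assms(1)]) (simp add: grad_def smooth_on_partial assms)

lemma smooth_on_laplacian: "open S \<Longrightarrow> smooth_on S g \<Longrightarrow> smooth_on S (laplacian g)"
  unfolding laplacian_def by (intro smooth_on_sum smooth_on_partial)

lemma smooth_on_div_div_tensor: "open S \<Longrightarrow> smooth_on S W \<Longrightarrow> smooth_on S (div_div_tensor W)"
  unfolding div_div_tensor_def
  by (intro smooth_on_sum smooth_on_partial smooth_on_mult smooth_on_vec_nth)

lemma diverg_curl:
  assumes "open S" "x \<in> S" "smooth_on S W"
  shows "diverg (curl W) x = 0"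
proof -
  have comp: "smooth_on S (\<lambda>y. W y $ i)" for i by (intro smooth_on_vec_nth assms)
  have d: "partial k (\<lambda>y. partial i (\<lambda>y. W y $ j) y - partial i' (\<lambda>y. W y $ j') y) x =
      partial k (partial i (\<lambda>y. W y $ j)) x - partial k (partial i' (\<lambda>y. W y $ j')) x" for i j k i' j'
    by (rule partial_diff[OF _ _ assms(2)]) (intro smooth_on_partial comp)+
  have c: "partial i (partial j (\<lambda>y. W y $ k)) x = partial j (partial i (\<lambda>y. W y $ k)) x" for i j k
    by (rule partial_commute[OF assms(1,2) comp])
  show ?thesis
    by (simp only: diverg_def sum_3 curl_def vector_3 d c[of 2 1] c[of 3 1] c[of 3 2])
qed

text \<open>Summing the derivatives of \<open>W_i W_j\<close> over \<open>j\<close> gives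
  \<open>W_i div W\<close> plus the advection of \<open>W_i\<close>. The first term has to vanish on
  a neighbourhood and not just at \<open>x\<close>, because the identity is differentiated once
  more.\<close>

lemma div_div_tensor_eq_diverg_advect:
  assumes "open S" "x \<in> S" "smooth_on S W" "\<And>y. y \<in> S \<Longrightarrow> diverg W y = 0"
  shows "div_div_tensor W x = diverg (advect W) x"
proof -
  have W: "smooth_on S (\<lambda>y. W y $ i)" for i by (intro smooth_on_vec_nth assms)
  have dW: "W differentiable (at y)" if "y \<in> S" for y
    using smooth_on_has_derivative[OF assms(3) that] by (auto simp: differentiable_def)
  have "(\<Sum>j\<in>UNIV. partial i (partial j (\<lambda>y. W y $ i * W y $ j)) x) =
      partial i (\<lambda>y. advect W y $ i) x" for i
  proof -
    have "(\<Sum>j\<in>UNIV. partial i (partial j (\<lambda>y. W y $ i * W y $ j)) x) =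
        partial i (\<lambda>y. \<Sum>j\<in>UNIV. partial j (\<lambda>y. W y $ i * W y $ j) y) x"
      by (rule partial_sum[symmetric, where S = S]) (intro smooth_on_partial smooth_on_mult W assms)+
    also have "\<dots> = partial i (\<lambda>y. advect W y $ i) x"
    proof (rule partial_cong_open[OF assms(1,2)])
      fix y assume y: "y \<in> S"
      have "(\<Sum>j\<in>UNIV. partial j (\<lambda>y. W y $ i * W y $ j) y) =
          W y $ i * diverg W y + (\<Sum>j\<in>UNIV. partial j W y $ i * W y $ j)"
        by (simp add: partial_mult[OF W W y] sum.distrib diverg_def sum_distrib_left
            partial_vec_nth[OF dW[OF y]])
      then show "(\<Sum>j\<in>UNIV. partial j (\<lambda>y. W y $ i * W y $ j) y) = advect W y $ i"
        by (simp add: assms(4)[OF y] advect_def mult.commute)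
    qed
    finally show ?thesis .
  qed
  then show ?thesis by (simp add: div_div_tensor_def diverg_def)
qed

text \<open>The divergence of the Euler equations. It makes the formula for the pressure source
  vanish wherever the tapered flow solves them, which lets the source be smooth across the edges of
  the tapering shell.\<close>

lemma stationary_Euler_pressure_equation:
  assumes "open S" "x \<in> S" "smooth_on S W" "smooth_on S p"
    and "\<And>y. y \<in> S \<Longrightarrow> diverg W y = 0" "\<And>y. y \<in> S \<Longrightarrow> advect W y + grad p y = 0"
  shows "laplacian p x + div_div_tensor W x = 0"
proof -
  have "laplacian p x + div_div_tensor W x =
      (\<Sum>i\<in>UNIV. partial i (\<lambda>y. grad p y $ i) x + partial i (\<lambda>y. advect W y $ i) x)"
    by (simp add: div_div_tensor_eq_diverg_advect[OF assms(1-3,5)] laplacian_def diverg_def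
        grad_def sum.distrib)
  also have "\<dots> = (\<Sum>i\<in>UNIV. partial i (\<lambda>y. grad p y $ i + advect W y $ i) x)"
    by (intro sum.cong refl partial_add[symmetric, where S = S] smooth_on_vec_nth smooth_on_grad
        smooth_on_advect assms)
  also have "\<dots> = (\<Sum>i\<in>UNIV. partial i (\<lambda>y. 0 :: real) x)"
  proof (intro sum.cong refl partial_cong_open[OF assms(1,2)])
    fix i y assume "y \<in> S"
    then show "grad p y $ i + advect W y $ i = 0"
      using assms(6)[of y] by (metis add.commute vector_add_component zero_index)
  qed
  also have "\<dots> = 0" by (simp add: partial_def)
  finally show ?thesis .
qed

section \<open>Integration on \<open>\<real>\<^sup>n\<close>\<close>

lemma integrable_continuous_compact_support:
  fixes f :: "'a::euclidean_space \<Rightarrow> 'b::{banach, second_countable_topology}"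
  assumes "continuous_on UNIV f" "\<And>x. R < norm x \<Longrightarrow> f x = 0"
  shows "integrable lborel f"
proof -
  have "integrable lborel (\<lambda>x. indicator (cball 0 R) x *\<^sub>R f x)"
    by (rule borel_integrable_compact) (auto intro: continuous_on_subset[OF assms(1)])
  moreover have "(\<lambda>x. indicator (cball 0 R) x *\<^sub>R f x) = f"
    using assms(2) by (auto simp: fun_eq_iff indicator_def not_le)
  ultimately show ?thesis by simp
qed

text \<open>Turns a field that is singular at the origin, multiplied by a cutoff that removes a ball
  around it, into a globally continuous integrand.\<close>

lemma continuous_on_UNIV_if_zero_near_0:
  fixes f :: "'a::real_normed_vector \<Rightarrow> 'b::real_normed_vector"
  assumes "continuous_on (- {0}) f" "0 < r" "\<And>x. norm x < r \<Longrightarrow> f x = 0"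
  shows "continuous_on UNIV f"
proof -
  have "continuous_on (ball 0 r) f"
    by (rule continuous_on_eq[of _ "\<lambda>x. 0"]) (use assms(3) in auto)
  then have "continuous_on (- {0} \<union> ball 0 r) f"
    by (intro continuous_on_open_Un assms) auto
  moreover have "- {0} \<union> ball 0 r = (UNIV :: 'a set)" using assms(2) by auto
  ultimately show ?thesis by simp
qed

lemma borel_measurable_continuous_off_0:
  fixes f :: "'a::euclidean_space \<Rightarrow> 'b::real_normed_vector"
  assumes "continuous_on (- {0}) f"
  shows "f \<in> borel_measurable borel"
  by (rule borel_measurable_continuous_countable_exceptions[of "{0}"]) (use assms in auto)

text \<open>One change of variables with three uses: translation invariance (\<open>c = 1\<close>),
  symmetry of the convolution (\<open>c = -1\<close>), and comparison of fluxes at different scales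
  (\<open>t = 0\<close>).\<close>

lemma lborel_integral_affine:
  fixes f :: "'a::euclidean_space \<Rightarrow> real"
  assumes f: "f \<in> borel_measurable borel" and "c \<noteq> 0"
  shows "(LINT x|lborel. f x) = \<bar>c\<bar> ^ DIM('a) * (LINT x|lborel. f (t + c *\<^sub>R x))"
proof -
  have "(LINT x|lborel. f x) =
      integral\<^sup>L (density (distr lborel borel (\<lambda>x. t + c *\<^sub>R x)) (\<lambda>_. \<bar>c\<bar>^DIM('a))) f"
    using lborel_affine[OF assms(2), of t] by simp
  also have "\<dots> = integral\<^sup>L (distr lborel borel (\<lambda>x. t + c *\<^sub>R x)) (\<lambda>x. \<bar>c\<bar>^DIM('a) *\<^sub>R f x)"
    by (rule integral_density) (use f in auto)
  also have "\<dots> = (LINT x|lborel. \<bar>c\<bar>^DIM('a) *\<^sub>R f (t + c *\<^sub>R x))"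
    by (rule integral_distr) (use f in auto)
  finally show ?thesis by simp
qed

text \<open>Difference quotients of \<open>w\<close> have integral 0 by translation invariance. They
  are values of the derivative at intermediate points, hence bounded and supported in one fixed
  ball, and dominated convergence passes to the limit.\<close>

lemma integral_directional_derivative_eq_0:
  fixes w :: "'a::euclidean_space \<Rightarrow> real"
  assumes w: "\<And>x. (w has_derivative w' x) (at x)"
    and cont: "continuous_on UNIV (\<lambda>x. w' x e)"
    and supp: "\<And>x. R < norm x \<Longrightarrow> w x = 0"
  shows "integrable lborel (\<lambda>x. w' x e)" "(LINT x|lborel. w' x e) = 0"
proof -
  define t where "t n = 1 / real (Suc n)" for n
  have t: "0 < t n" "t n \<le> 1" for n by (auto simp: t_def)
  have w_cont: "continuous_on UNIV w"
    by (intro continuous_at_imp_continuous_on ballI has_derivative_continuous[OF w])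
  then have w_meas: "w \<in> borel_measurable borel" by (rule borel_measurable_continuous_onI)
  have int_w: "integrable lborel w"
    by (rule integrable_continuous_compact_support[OF w_cont supp])
  have int_shift: "integrable lborel (\<lambda>x. w (x + t n *\<^sub>R e))" for n
  proof (rule integrable_continuous_compact_support[where R = "R + norm e"])
    show "continuous_on UNIV (\<lambda>x. w (x + t n *\<^sub>R e))"
      by (rule continuous_on_compose2[OF w_cont]) (auto intro!: continuous_intros)
    fix x :: 'a assume "R + norm e < norm x"
    moreover have "norm x \<le> norm (x + t n *\<^sub>R e) + norm (t n *\<^sub>R e)"
      using norm_triangle_ineq4[of "x + t n *\<^sub>R e" "t n *\<^sub>R e"] by simp
    moreover have "norm (t n *\<^sub>R e) \<le> norm e" using t[of n] by (simp add: mult_left_le_one_le)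
    ultimately show "w (x + t n *\<^sub>R e) = 0" by (intro supp) linarith
  qed
  define s where "s n x = (w (x + t n *\<^sub>R e) - w x) / t n" for n x
  have mean: "\<exists>z. s n x = w' (x + z *\<^sub>R e) e \<and> 0 < z \<and> z < 1" for n x
  proof -
    have "\<exists>z. 0 < z \<and> z < t n \<and>
        w (x + t n *\<^sub>R e) - w (x + 0 *\<^sub>R e) = (t n - 0) * w' (x + z *\<^sub>R e) e"
      by (rule MVT2[OF t(1)]) (intro has_real_derivative_along_line w)
    then obtain z where "0 < z" "z < t n" "w (x + t n *\<^sub>R e) - w x = t n * w' (x + z *\<^sub>R e) e"
      by auto
    then show ?thesis using t[of n] by (intro exI[of _ z]) (auto simp: s_def)
  qed
  \<comment> \<open>A quotient at \<open>x\<close> can be nonzero only for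
    \<open>norm x \<le> R + norm e\<close>, and it is the derivative at \<open>x + z e\<close> with
    \<open>z < 1\<close>; hence the radius with two copies of \<open>norm e\<close>.\<close>
  have "compact ((\<lambda>x. w' x e) ` cball 0 (R + 2 * norm e))"
    by (rule compact_continuous_image) (auto intro: continuous_on_subset[OF cont])
  then have "bounded ((\<lambda>x. w' x e) ` cball 0 (R + 2 * norm e))" by (rule compact_imp_bounded)
  then obtain M where M: "\<And>x. norm x \<le> R + 2 * norm e \<Longrightarrow> \<bar>w' x e\<bar> \<le> M"
    unfolding bounded_iff by (metis imageI mem_cball_0 real_norm_def)
  define b where "b x = M * indicator (cball 0 (R + norm e)) x" for x :: 'a
  have bound: "\<bar>s n x\<bar> \<le> b x" for n x
  proof (cases "norm x \<le> R + norm e")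
    case True
    obtain z where z: "s n x = w' (x + z *\<^sub>R e) e" "0 < z" "z < 1" using mean by blast
    have "norm (x + z *\<^sub>R e) \<le> norm x + norm e"
      using z norm_triangle_ineq[of x "z *\<^sub>R e"] mult_left_le_one_le[of "norm e" z] by simp
    then show ?thesis using True M[of "x + z *\<^sub>R e"] z by (simp add: b_def)
  next
    case False
    have "norm x \<le> norm (x + t n *\<^sub>R e) + norm (t n *\<^sub>R e)"
      using norm_triangle_ineq4[of "x + t n *\<^sub>R e" "t n *\<^sub>R e"] by simp
    moreover have "norm (t n *\<^sub>R e) \<le> norm e" using t[of n] by (simp add: mult_left_le_one_le)
    ultimately have "w (x + t n *\<^sub>R e) = 0" using False by (intro supp) linarith
    moreover have "w x = 0" using False norm_ge_zero[of e] by (intro supp) linarith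
    ultimately show ?thesis using False by (simp add: s_def b_def)
  qed
  have lim: "(\<lambda>n. s n x) \<longlonglongrightarrow> w' x e" for x
  proof -
    have "((\<lambda>h. w (x + h *\<^sub>R e)) has_real_derivative w' x e) (at 0)"
      by (rule has_real_derivative_along_line) (use w in simp)
    then have "(\<lambda>h. (w (x + h *\<^sub>R e) - w x) / h) \<midarrow>0\<rightarrow> w' x e" by (simp add: DERIV_def)
    moreover have "t \<longlonglongrightarrow> 0"
      using LIMSEQ_inverse_real_of_nat by (simp add: t_def[abs_def] divide_inverse)
    then have "filterlim t (at 0) sequentially"
      unfolding filterlim_at using t by (auto intro!: always_eventually simp: less_imp_neq[symmetric])
    ultimately show ?thesis unfolding s_def by (rule filterlim_compose)
  qed
  have meas: "(\<lambda>x. w' x e) \<in> borel_measurable lborel" "s n \<in> borel_measurable lborel" for n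
    using borel_measurable_continuous_onI[OF cont] borel_measurable_integrable[OF int_w]
      borel_measurable_integrable[OF int_shift[of n]] by (auto simp: s_def[abs_def])
  have b: "integrable lborel b"
    unfolding b_def by (intro integrable_mult_right integrable_real_indicator)
      (use emeasure_lborel_cball_finite[of 0 "R + norm e"] in auto)
  show "integrable lborel (\<lambda>x. w' x e)"
    by (rule integrable_dominated_convergence[where s = s, OF meas b]) (use lim bound in auto)
  have "(LINT x|lborel. s n x) = 0" for n
  proof -
    have "(LINT x|lborel. w (x + t n *\<^sub>R e)) = (LINT x|lborel. w x)"
      using lborel_integral_affine[OF w_meas, of 1 "t n *\<^sub>R e"] by (simp add: add.commute)
    then show ?thesis using int_w int_shift by (simp add: s_def)
  qed
  moreover have "(\<lambda>n. LINT x|lborel. s n x) \<longlonglongrightarrow> (LINT x|lborel. w' x e)"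
    by (rule integral_dominated_convergence[where s = s, OF meas b]) (use lim bound in auto)
  ultimately show "(LINT x|lborel. w' x e) = 0" by (simp add: LIMSEQ_const_iff)
qed

text \<open>The dyadic shell decomposition \<open>\<bar>x\<bar>\<^sup>-\<^sup>2 \<le> \<Sum>n. 4\<^sup>n\<^sup>+\<^sup>1 1\<^bsub>\<bar>x\<bar> \<le> 2\<^sup>-\<^sup>n\<^esub>\<close> replaces polar coordinates.\<close>

lemma integrable_inverse_square_cball:
  assumes "0 < R"
  shows "integrable lborel (\<lambda>x::real^3. indicator (cball 0 R) x / (norm x)\<^sup>2)"
proof (rule integrableI_bounded)
  let ?f = "\<lambda>x::real^3. indicator (cball 0 R) x / (norm x)\<^sup>2 :: real"
  define g where "g n x = ennreal (4 ^ Suc n / R\<^sup>2) * indicator (cball 0 (R / 2 ^ n)) x" for n and x :: "real^3"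
  have "indicator (cball 0 R) \<in> borel_measurable (borel :: (real^3) measure)"
    by (rule borel_measurable_indicator) simp
  then show "?f \<in> borel_measurable lborel" by measurable
  have le: "ennreal (norm (?f x)) \<le> (\<Sum>n. g n x)" for x
  proof (cases "x = 0 \<or> R < norm x")
    case True
    then show ?thesis by auto
  next
    case False
    then have x: "0 < norm x" "norm x \<le> R" by auto
    have "\<exists>n. R / 2 ^ Suc n < norm x"
    proof -
      obtain n where "R / norm x < 2 ^ n" using real_arch_pow[of 2 "R / norm x"] by auto
      also have "(2::real) ^ n \<le> 2 ^ Suc n" by simp
      finally show ?thesis using x by (auto simp: field_simps)
    qed
    \<comment> \<open>The index of the dyadic shell containing \<open>x\<close>: being least gives
      the upper bound \<open>R / 2 ^ n\<close> on \<open>norm x\<close>, which for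
      \<open>n = 0\<close> is the bound by \<open>R\<close> itself.\<close>
    define n where "n = (LEAST n. R / 2 ^ Suc n < norm x)"
    have n: "R / 2 ^ Suc n < norm x"
      unfolding n_def by (rule LeastI_ex) fact
    have n': "norm x \<le> R / 2 ^ n"
    proof (cases n)
      case 0
      then show ?thesis using x by simp
    next
      case (Suc m)
      then have "\<not> R / 2 ^ Suc m < norm x" 
        using not_less_Least[of m "\<lambda>n. R / 2 ^ Suc n < norm x"] by (simp add: n_def)
      then show ?thesis using Suc by simp
    qed
    have sq: "(R / 2 ^ Suc n)\<^sup>2 \<le> (norm x)\<^sup>2" using n assms by (intro power_mono) auto
    have "0 < (norm x)\<^sup>2 * (R / 2 ^ Suc n)\<^sup>2"
      using assms x(1) by (intro mult_pos_pos zero_less_power) auto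
    then have "1 / (norm x)\<^sup>2 \<le> 1 / (R / 2 ^ Suc n)\<^sup>2"
      by (intro divide_left_mono[OF sq]) simp_all
    also have "\<dots> = 4 ^ Suc n / R\<^sup>2"
      using power_mult[of "2::real" 2 "Suc n"] power_mult[of "2::real" "Suc n" 2]
      by (simp add: power_divide mult.commute)
    finally have "ennreal (norm (?f x)) \<le> g n x"
      using x n' by (simp add: g_def indicator_def ennreal_leI)
    also have "\<dots> = sum (\<lambda>n. g n x) {n}" by simp
    also have "\<dots> \<le> (\<Sum>n. g n x)" by (rule sum_le_suminf) auto
    finally show ?thesis .
  qed
  \<comment> \<open>The weights grow like 4^n and the volumes shrink like 8^(-n), so the series is
    geometric with ratio 1/2.\<close>
  have int_g: "(\<integral>\<^sup>+x. g n x \<partial>lborel) = ennreal (4 * unit_ball_vol 3 * R * (1 / 2) ^ n)" for n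
  proof -
    have "(\<integral>\<^sup>+x. g n x \<partial>lborel) =
        ennreal (4 ^ Suc n / R\<^sup>2) * emeasure lborel (cball (0::real^3) (R / 2 ^ n))"
      by (simp add: g_def nn_integral_cmult_indicator)
    also have "\<dots> = ennreal (4 ^ Suc n / R\<^sup>2 * (unit_ball_vol 3 * (R / 2 ^ n) ^ 3))"
      using assms by (simp add: emeasure_cball ennreal_mult'[symmetric])
    also have "4 ^ Suc n / R\<^sup>2 * (unit_ball_vol 3 * (R / 2 ^ n) ^ 3) =
        4 * unit_ball_vol 3 * R * (1 / 2) ^ n"
    proof -
      have "(4::real) ^ n = 2 ^ n * 2 ^ n" by (simp flip: power_mult_distrib)
      then show ?thesis using assms
        by (simp add: power_divide power2_eq_square power3_eq_cube)
    qed
    finally show ?thesis .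
  qed
  have "(\<integral>\<^sup>+x. ennreal (norm (?f x)) \<partial>lborel) \<le> (\<integral>\<^sup>+x. (\<Sum>n. g n x) \<partial>lborel)"
    by (intro nn_integral_mono le)
  also have "\<dots> = (\<Sum>n. \<integral>\<^sup>+x. g n x \<partial>lborel)"
    unfolding g_def
    by (intro nn_integral_suminf borel_measurable_times_ennreal borel_measurable_const
        borel_measurable_indicator)
      simp
  also have "\<dots> = ennreal (4 * unit_ball_vol 3 * R * (1 / (1 - 1 / 2)))"
    unfolding int_g by (intro suminf_ennreal_eq sums_mult geometric_sums) (use assms in auto)
  also have "\<dots> < \<infinity>" by simp
  finally show "(\<integral>\<^sup>+x. ennreal (norm (?f x)) \<partial>lborel) < \<infinity>" .
qed

lemma integrable_bound_inverse_square:
  fixes f :: "real^3 \<Rightarrow> real"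
  assumes "f \<in> borel_measurable borel" "0 < R"
    "\<And>x. x \<noteq> 0 \<Longrightarrow> norm x \<le> R \<Longrightarrow> \<bar>f x\<bar> \<le> C / (norm x)\<^sup>2" "\<And>x. R < norm x \<Longrightarrow> f x = 0"
  shows "integrable lborel f"
proof (rule Bochner_Integration.integrable_bound)
  show "integrable lborel (\<lambda>x::real^3. C * (indicator (cball 0 R) x / (norm x)\<^sup>2))"
    by (intro integrable_mult_right integrable_inverse_square_cball assms)
  show "f \<in> borel_measurable lborel" using assms(1) by simp
  show "AE x in lborel. norm (f x) \<le> norm (C * (indicator (cball 0 R) x / (norm x)\<^sup>2))"
    using AE_lborel_singleton[of "0::real^3"]
  proof eventually_elim
    case (elim x)
    then show ?case using assms(3,4)[of x]
      by (cases "norm x \<le> R") (auto intro: order_trans[OF _ divide_right_mono[OF abs_ge_self]])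
  qed
qed

text \<open>Only \<open>D\<theta>(U)\<close> survives in \<open>div (\<theta> U)\<close> when \<open>div U = 0\<close>.\<close>

lemma integral_transport_eq_0:
  fixes \<theta> :: "real^3 \<Rightarrow> real" and U :: "real^3 \<Rightarrow> real^3"
  assumes \<theta>: "Ck_on (Suc 0) (- {0}) \<theta>" and U: "Ck_on (Suc 0) (- {0}) U"
    and div: "\<And>x. x \<noteq> 0 \<Longrightarrow> diverg U x = 0"
    and r: "0 < r" "\<And>x. norm x < r \<Longrightarrow> \<theta> x = 0"
    and R: "\<And>x. R < norm x \<Longrightarrow> \<theta> x *\<^sub>R U x = 0"
  shows "integrable lborel (\<lambda>x. frechet_derivative \<theta> (at x) (U x))"
    "(LINT x|lborel. frechet_derivative \<theta> (at x) (U x)) = 0"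
proof -
  let ?w = "\<lambda>i x. \<theta> x * U x $ i"
  let ?w' = "\<lambda>i x. frechet_derivative (?w i) (at x)"
  have opn: "open (- {0 :: real^3})" by auto
  have "Ck_on (Suc 0) UNIV (?w i)" for i
  proof -
    have "Ck_on (Suc 0) (- {0}) (?w i)" by (intro Ck_on_mult Ck_on_vec_nth \<theta> U opn)
    \<comment> \<open>\<open>U\<close> may blow up at the origin, but the product is identically 0
      near it.\<close>
    moreover have "Ck_on (Suc 0) (ball 0 r) (?w i)"
      by (subst Ck_on_cong[OF open_ball, where g = "\<lambda>x. 0"]) (use r in \<open>auto simp: Ck_on_const\<close>)
    ultimately have "Ck_on (Suc 0) (- {0} \<union> ball 0 r) (?w i)" by (intro Ck_on_Un opn open_ball)
    moreover have "- {0} \<union> ball 0 r = (UNIV :: (real^3) set)" using r by auto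
    ultimately show ?thesis by simp
  qed
  note w = this
  have "?w i x = 0" if "R < norm x" for i x
    using arg_cong[OF R[OF that], of "\<lambda>v. v $ i"] by simp
  note supp = this
  have int: "integrable lborel (\<lambda>x. ?w' i x (axis i 1))" "(LINT x|lborel. ?w' i x (axis i 1)) = 0" for i
    using integral_directional_derivative_eq_0[where w = "?w i" and w' = "?w' i" and R = R and e = "axis i 1"]
      Ck_on_Suc_has_derivative[OF w[of i]] Ck_on_frechet_derivative[OF w[of i]] supp by auto
  have "(\<Sum>i\<in>UNIV. ?w' i x (axis i 1)) = frechet_derivative \<theta> (at x) (U x)" if x: "x \<noteq> 0" for x
  proof -
    have d\<theta>: "(\<theta> has_derivative frechet_derivative \<theta> (at x)) (at x)"
      by (rule Ck_on_Suc_has_derivative[OF \<theta>]) (use x in simp)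
    have dU: "((\<lambda>x. U x $ i) has_derivative frechet_derivative (\<lambda>x. U x $ i) (at x)) (at x)" for i
      by (rule Ck_on_Suc_has_derivative[OF Ck_on_vec_nth[OF opn U]]) (use x in simp)
    have "?w' i x = (\<lambda>h. \<theta> x * frechet_derivative (\<lambda>x. U x $ i) (at x) h +
        frechet_derivative \<theta> (at x) h * U x $ i)" for i
      by (rule frechet_derivative_at[symmetric, OF has_derivative_mult[OF d\<theta> dU]])
    then have "(\<Sum>i\<in>UNIV. ?w' i x (axis i 1)) =
        \<theta> x * diverg U x + (\<Sum>i\<in>UNIV. (U x $ i) *\<^sub>R frechet_derivative \<theta> (at x) (axis i 1))"
      by (simp add: sum.distrib diverg_def partial_def sum_distrib_left mult.commute)
    then show ?thesis
      using vec_linear_expand[OF bounded_linear.linear[OF has_derivative_bounded_linear[OF d\<theta>]]]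
      by (simp add: div[OF x])
  qed
  moreover have "frechet_derivative (?w i) (at 0) = (\<lambda>h. 0)" for i
    using frechet_derivative_cong_open[of "ball 0 r" 0 "?w i" "\<lambda>x. 0"] r by simp
  moreover have "frechet_derivative \<theta> (at 0) = (\<lambda>h. 0)"
    using frechet_derivative_cong_open[of "ball 0 r" 0 \<theta> "\<lambda>x. 0"] r by simp
  ultimately have eq: "frechet_derivative \<theta> (at x) (U x) = (\<Sum>i\<in>UNIV. ?w' i x (axis i 1))" for x
    by (cases "x = 0") auto
  show "integrable lborel (\<lambda>x. frechet_derivative \<theta> (at x) (U x))"
    "(LINT x|lborel. frechet_derivative \<theta> (at x) (U x)) = 0"
    unfolding eq using int by (simp_all add: Bochner_Integration.integral_sum)
qed

section \<open>The Newtonian potential\<close>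

lemma continuous_compact_support_bounded:
  fixes q :: "'a::euclidean_space \<Rightarrow> real"
  assumes "continuous_on UNIV q" "\<And>x. R < norm x \<Longrightarrow> q x = 0"
  obtains M where "0 \<le> M" "\<And>x. \<bar>q x\<bar> \<le> M"
proof -
  have "compact (q ` cball 0 R)"
    by (rule compact_continuous_image) (auto intro: continuous_on_subset[OF assms(1)])
  then have "bounded (q ` cball 0 R)" by (rule compact_imp_bounded)
  then obtain M where M: "\<And>x. norm x \<le> R \<Longrightarrow> \<bar>q x\<bar> \<le> M"
    unfolding bounded_iff by (metis imageI mem_cball_0 real_norm_def)
  have "\<bar>q x\<bar> \<le> \<bar>M\<bar>" for x
    using M[of x] assms(2)[of x] by (cases "norm x \<le> R") auto
  then show ?thesis by (intro that[of "\<bar>M\<bar>"]) auto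
qed

lemma borel_measurable_newtonian_potential [measurable]: "newtonian_potential \<in> borel_measurable borel"
  unfolding newtonian_potential_def[abs_def] by measurable

text \<open>On the ball of radius \<open>R\<close> the kernel is at most
  \<open>1 / norm y \<le> R / (norm y)^2\<close>, so the inverse-square criterion applies.\<close>

lemma integrable_newtonian_potential_mult:
  assumes g: "g \<in> borel_measurable borel" and R: "0 < R" "\<And>y. R < norm y \<Longrightarrow> g y = 0"
    and M: "\<And>y. \<bar>g y\<bar> \<le> M"
  shows "integrable lborel (\<lambda>y. newtonian_potential y * g y)"
proof (rule integrable_bound_inverse_square[where C = "R * M" and R = R])
  show "(\<lambda>y. newtonian_potential y * g y) \<in> borel_measurable borel"
    using g by measurable
  fix y :: "real^3"
  show "newtonian_potential y * g y = 0" if "R < norm y" using R that by simp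
  assume y: "y \<noteq> 0" "norm y \<le> R"
  have "1 \<le> 4 * pi" using pi_ge_two by linarith
  then have "norm y * 1 \<le> 4 * pi * norm y" using y by (simp add: mult_right_mono)
  then have "\<bar>newtonian_potential y\<bar> \<le> 1 / norm y"
    using y by (auto simp: newtonian_potential_def abs_mult intro!: divide_left_mono mult_pos_pos)
  also have "\<dots> = norm y / (norm y)\<^sup>2" using y by (simp add: power2_eq_square)
  also have "\<dots> \<le> R / (norm y)\<^sup>2" using y by (intro divide_right_mono) auto
  finally have "\<bar>newtonian_potential y\<bar> * \<bar>g y\<bar> \<le> R / (norm y)\<^sup>2 * M"
    using M[of y] R(1) by (intro mult_mono) auto
  then show "\<bar>newtonian_potential y * g y\<bar> \<le> R * M / (norm y)\<^sup>2" by (simp add: abs_mult)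
qed fact

text \<open>Moves \<open>x\<close> from the singular kernel to the density, so that continuity and
  differentiability in \<open>x\<close> are inherited from \<open>q\<close>.\<close>

lemma newtonian_convolution_commute:
  assumes "q \<in> borel_measurable borel"
  shows "newtonian_convolution q x = (LINT y|lborel. newtonian_potential y * q (x - y))"
proof -
  have "(\<lambda>y. newtonian_potential (x - y) * q y) \<in> borel_measurable borel"
    using assms by measurable
  from lborel_integral_affine[OF this, of "-1" x] show ?thesis
    by (simp add: newtonian_convolution_def)
qed

text \<open>The radius \<open>R + B\<close> serves all shifts of norm at most \<open>B\<close>,
  which gives a single dominating function for a bounded sequence of shifts.\<close>

lemma shifted_support:
  assumes "\<And>x. R < norm x \<Longrightarrow> q x = 0" "norm a \<le> B" "R + B < norm y"
  shows "q (a - y) = 0"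
proof (rule assms(1))
  have "norm y \<le> norm (a - y) + norm a"
    by (metis norm_minus_commute norm_triangle_sub add.commute)
  then show "R < norm (a - y)" using assms(2,3) by linarith
qed

lemma continuous_on_newtonian_convolution:
  assumes q: "continuous_on UNIV q" and R: "0 < R" "\<And>x. R < norm x \<Longrightarrow> q x = 0"
  shows "continuous_on UNIV (newtonian_convolution q)"
  unfolding continuous_on_sequentially
proof (intro allI ballI impI, elim conjE)
  fix x :: "nat \<Rightarrow> real^3" and a assume lim: "x \<longlonglongrightarrow> a"
  obtain M where M: "0 \<le> M" "\<And>x. \<bar>q x\<bar> \<le> M"
    using continuous_compact_support_bounded[OF q R(2)] by blast
  obtain B where B: "0 < B" "\<And>n. norm (x n) \<le> B"
    using Bseq_def[of x] convergentI[OF lim, THEN convergent_imp_Bseq] by auto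
  have q_meas [measurable]: "q \<in> borel_measurable borel" by (rule borel_measurable_continuous_onI[OF q])
  let ?w = "\<lambda>y. \<bar>newtonian_potential y * (M * indicator (cball 0 (R + B)) y)\<bar>"
  have w: "integrable lborel ?w"
    by (intro integrable_abs integrable_newtonian_potential_mult[where R = "R + B" and M = M]
        borel_measurable_times borel_measurable_indicator borel_measurable_const)
      (use R B M in \<open>auto simp: indicator_def\<close>)
  have "(\<lambda>n. LINT y|lborel. newtonian_potential y * q (x n - y)) \<longlonglongrightarrow>
      (LINT y|lborel. newtonian_potential y * q (a - y))"
  proof (rule integral_dominated_convergence[OF _ _ w])
    show "AE y in lborel. (\<lambda>n. newtonian_potential y * q (x n - y)) \<longlonglongrightarrow> newtonian_potential y * q (a - y)"
    proof (intro always_eventually allI tendsto_mult tendsto_const)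
      fix y
      have "isCont q (a - y)" using q by (simp add: continuous_on_eq_continuous_at)
      then show "(\<lambda>n. q (x n - y)) \<longlonglongrightarrow> q (a - y)"
        by (rule isCont_tendsto_compose) (intro tendsto_intros lim)
    qed
    fix n
    have "norm (newtonian_potential y * q (x n - y)) \<le> ?w y" for y
    proof (cases "norm y \<le> R + B")
      case True
      then show ?thesis using M by (auto simp: abs_mult intro!: mult_left_mono)
    next
      case False
      then show ?thesis using shifted_support[of R q, OF R(2) B(2)[of n]] by simp
    qed
    then show "AE y in lborel. norm (newtonian_potential y * q (x n - y)) \<le> ?w y" by simp
  qed measurable
  then show "(newtonian_convolution q \<circ> x) \<longlonglongrightarrow> newtonian_convolution q a"
    by (simp add: newtonian_convolution_commute[OF q_meas] o_def)
qed

lemma linear_expand_Basis: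
  assumes "linear L"
  shows "L h = (\<Sum>i\<in>Basis. (h \<bullet> i) *\<^sub>R L i)"
proof -
  have "L h = L (\<Sum>i\<in>Basis. (h \<bullet> i) *\<^sub>R i)" by (simp only: euclidean_representation)
  then show ?thesis by (simp only: linear_sum[OF assms] linear_cmul[OF assms] o_def)
qed

text \<open>\<open>Ck_on\<close> gives bounds one direction at a time; expansion in
  \<open>Basis\<close> makes them uniform in the direction.\<close>

lemma frechet_derivative_bounded_on_compact:
  fixes q :: "'a::euclidean_space \<Rightarrow> real"
  assumes q: "Ck_on (Suc 0) S q" and K: "compact K" "K \<subseteq> S"
  obtains L where "0 \<le> L" "\<And>z h. z \<in> K \<Longrightarrow> \<bar>frechet_derivative q (at z) h\<bar> \<le> L * norm h"
proof -
  define D where "D h z = frechet_derivative q (at z) h" for h z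
  have "\<exists>M\<ge>0. \<forall>z\<in>K. \<bar>D i z\<bar> \<le> M" for i
  proof -
    have "compact (D i ` K)"
      using q K by (intro compact_continuous_image) (auto simp: D_def[abs_def] intro: continuous_on_subset)
    then have "bounded (D i ` K)" by (rule compact_imp_bounded)
    then obtain M where "0 < M" "\<forall>y\<in>D i ` K. norm y \<le> M" by (auto simp: bounded_pos)
    then show ?thesis by (intro exI[of _ M]) auto
  qed
  then obtain M where M: "\<And>i. 0 \<le> M i" "\<And>i z. z \<in> K \<Longrightarrow> \<bar>D i z\<bar> \<le> M i" by metis
  have "\<bar>D h z\<bar> \<le> (\<Sum>i\<in>Basis. M i) * norm h" if z: "z \<in> K" for h z
  proof -
    have lin: "linear (\<lambda>h. D h z)"
      unfolding D_def using z K
      by (intro bounded_linear.linear[OF has_derivative_bounded_linear[OF Ck_on_Suc_has_derivative[OF q]]])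
        auto
    have "\<bar>D h z\<bar> \<le> (\<Sum>i\<in>Basis. \<bar>(h \<bullet> i) * D i z\<bar>)"
      by (subst linear_expand_Basis[OF lin]) (simp only: real_scaleR_def sum_abs)
    also have "\<dots> \<le> (\<Sum>i\<in>Basis. M i * norm h)"
    proof (rule sum_mono)
      fix i :: 'a assume "i \<in> Basis"
      then show "\<bar>(h \<bullet> i) * D i z\<bar> \<le> M i * norm h"
        using mult_mono[OF M(2)[OF z, of i] Basis_le_norm[of i h] M(1)[of i]]
        by (simp add: abs_mult mult.commute)
    qed
    also have "\<dots> = (\<Sum>i\<in>Basis. M i) * norm h" by (simp add: sum_distrib_right)
    finally show ?thesis .
  qed
  then show ?thesis using M(1) by (intro that[of "\<Sum>i\<in>Basis. M i"]) (auto simp: D_def sum_nonneg)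
qed

text \<open>All differentiation falls on \<open>q\<close>. Divided by \<open>norm h\<close>, the
  first-order remainder of \<open>q\<close> tends to 0 pointwise and stays bounded on a common ball.
  Since the kernel is locally integrable, dominated convergence carries this over to the
  convolution.\<close>

lemma has_derivative_newtonian_convolution:
  assumes q: "Ck_on (Suc 0) UNIV q" and R: "0 < R" "\<And>x. R < norm x \<Longrightarrow> q x = 0"
  shows "(newtonian_convolution q has_derivative
    (\<lambda>h. \<Sum>i\<in>Basis. (h \<bullet> i) * newtonian_convolution (\<lambda>z. frechet_derivative q (at z) i) x)) (at x)"
proof -
  define D where "D h z = frechet_derivative q (at z) h" for h z
  have dq: "(q has_derivative (\<lambda>h. D h z)) (at z)" for z
    using Ck_on_Suc_has_derivative[OF q, of z] by (simp add: D_def)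
  have D_cont: "continuous_on UNIV (D h)" for h
    using q by (simp add: D_def[abs_def])
  have D_supp: "D h z = 0" if "R < norm z" for h z
  proof -
    have "open {z :: real^3. R < norm z}" by (intro open_Collect_less continuous_intros)
    from frechet_derivative_cong_open[OF this, of z q "\<lambda>z. 0"] show ?thesis
      using that R(2) by (simp add: D_def)
  qed
  have expand: "D h z = (\<Sum>i\<in>Basis. (h \<bullet> i) * D i z)" for h z
    by (rule linear_expand_Basis[OF bounded_linear.linear[OF has_derivative_bounded_linear[OF dq]],
          unfolded real_scaleR_def])
  obtain L where L0: "0 \<le> L" and LR: "\<And>z h. z \<in> cball 0 R \<Longrightarrow> \<bar>D h z\<bar> \<le> L * norm h"
    using frechet_derivative_bounded_on_compact[OF q _ subset_UNIV, of "cball 0 R"]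
    unfolding D_def by auto
  have L: "\<bar>D h z\<bar> \<le> L * norm h" for h z
    using LR[of z h] D_supp[of z h] L0 by (cases "norm z \<le> R") auto
  have Lip: "\<bar>q (z + h) - q z\<bar> \<le> L * norm h" for z h
  proof -
    have "\<exists>s. 0 < s \<and> s < 1 \<and> q (z + 1 *\<^sub>R h) - q (z + 0 *\<^sub>R h) = (1 - 0) * D h (z + s *\<^sub>R h)"
      by (rule MVT2) (auto intro: has_real_derivative_along_line dq)
    then show ?thesis using L by auto
  qed
  have q_cont: "continuous_on UNIV q" by (rule Ck_on_imp_continuous_on[OF q])
  have q_meas [measurable]: "q \<in> borel_measurable borel" by (rule borel_measurable_continuous_onI[OF q_cont])
  have D_meas [measurable]: "D h \<in> borel_measurable borel" for h
    by (rule borel_measurable_continuous_onI[OF D_cont])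
  have int: "integrable lborel (\<lambda>y. newtonian_potential y * g (a - y))"
    if g: "continuous_on UNIV g" "\<And>x. R < norm x \<Longrightarrow> g x = 0" for g a
  proof -
    obtain K where K: "\<And>x. \<bar>g x\<bar> \<le> K" using continuous_compact_support_bounded[OF g] by blast
    have [measurable]: "g \<in> borel_measurable borel" by (rule borel_measurable_continuous_onI[OF g(1)])
    show ?thesis
    proof (rule integrable_newtonian_potential_mult[where R = "R + norm a" and M = K])
      show "(\<lambda>y. g (a - y)) \<in> borel_measurable borel" by measurable
    qed (use R(1) K shifted_support[of R g, OF g(2)] in \<open>auto intro: add_pos_nonneg\<close>)
  qed
  define e where "e h y = (q (x + h - y) - q (x - y) - D h (x - y)) / norm h" for h y
  let ?G = "\<lambda>h. \<Sum>i\<in>Basis. (h \<bullet> i) * newtonian_convolution (D i) x"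
  have remainder: "norm (newtonian_convolution q (x + h) - newtonian_convolution q x - ?G h) / norm h =
      \<bar>LINT y|lborel. newtonian_potential y * e h y\<bar>" for h
  proof -
    have "?G h = (LINT y|lborel. newtonian_potential y * D h (x - y))"
    proof -
      have "?G h = (\<Sum>i\<in>Basis. LINT y|lborel. (h \<bullet> i) * (newtonian_potential y * D i (x - y)))"
        by (simp add: newtonian_convolution_commute)
      also have "\<dots> = (LINT y|lborel. (\<Sum>i\<in>Basis. (h \<bullet> i) * (newtonian_potential y * D i (x - y))))"
        by (intro Bochner_Integration.integral_sum[symmetric] integrable_mult_right int D_cont D_supp)
      also have "\<dots> = (LINT y|lborel. newtonian_potential y * D h (x - y))"
        unfolding expand[of h] by (simp add: sum_distrib_left mult_ac)
      finally show ?thesis .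
    qed
    then have "newtonian_convolution q (x + h) - newtonian_convolution q x - ?G h =
        (LINT y|lborel. newtonian_potential y * q (x + h - y) - newtonian_potential y * q (x - y)
          - newtonian_potential y * D h (x - y))"
      using int[OF q_cont R(2), of "x + h"] int[OF q_cont R(2), of x] int[OF D_cont D_supp, of h x]
      by (simp add: newtonian_convolution_commute)
    then have "(newtonian_convolution q (x + h) - newtonian_convolution q x - ?G h) / norm h =
        (LINT y|lborel. (newtonian_potential y * q (x + h - y) - newtonian_potential y * q (x - y)
          - newtonian_potential y * D h (x - y)) / norm h)"
      by simp
    also have "\<dots> = (LINT y|lborel. newtonian_potential y * e h y)"
      by (simp add: e_def right_diff_distrib diff_divide_distrib)
    finally have *: "(newtonian_convolution q (x + h) - newtonian_convolution q x - ?G h) / norm h =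
        (LINT y|lborel. newtonian_potential y * e h y)" .
    show ?thesis unfolding *[symmetric] by simp
  qed
  have "(\<lambda>h. norm (newtonian_convolution q (x + h) - newtonian_convolution q x - ?G h) / norm h) \<midarrow>0\<rightarrow> 0"
    unfolding remainder tendsto_at_iff_sequentially
  proof (intro allI impI)
    fix X :: "nat \<Rightarrow> real^3" assume X0: "\<forall>n. X n \<in> UNIV - {0}" and X: "X \<longlonglongrightarrow> 0"
    have nz: "X n \<noteq> 0" for n using X0 by auto
    obtain B where B: "0 < B" "\<And>n. norm (X n) \<le> B"
      using Bseq_def[of X] convergentI[OF X, THEN convergent_imp_Bseq] by auto
    define B' where "B' = norm x + B"
    have B': "norm (x + X n) \<le> B'" "norm x \<le> B'" "0 < B'" for n
      using norm_triangle_ineq[of x "X n"] B(2)[of n] B(1)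
      by (auto simp: B'_def intro: add_nonneg_pos)
    \<comment> \<open>One \<open>L\<close> bounds the increment of \<open>q\<close>, the other its
      linear part.\<close>
    let ?w = "\<lambda>y. \<bar>newtonian_potential y * (2 * L * indicator (cball 0 (R + B')) y)\<bar>"
    have w: "integrable lborel ?w"
      by (intro integrable_abs integrable_newtonian_potential_mult[where R = "R + B'" and M = "2 * L"]
          borel_measurable_times borel_measurable_indicator borel_measurable_const)
        (use R B' L0 in \<open>auto simp: indicator_def\<close>)
    have "(\<lambda>n. LINT y|lborel. newtonian_potential y * e (X n) y) \<longlonglongrightarrow> (LINT y :: real^3|lborel. (0::real))"
    proof (rule integral_dominated_convergence[OF _ _ w])
      show "AE y in lborel. (\<lambda>n. newtonian_potential y * e (X n) y) \<longlonglongrightarrow> 0"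
      proof (intro always_eventually allI tendsto_mult_right_zero)
        fix y
        have "(\<lambda>h. norm (q (x - y + h) - q (x - y) - D h (x - y)) / norm h) \<midarrow>0\<rightarrow> 0"
          using dq[of "x - y"] by (simp add: has_derivative_at)
        then have "(\<lambda>n. norm (q (x - y + X n) - q (x - y) - D (X n) (x - y)) / norm (X n)) \<longlonglongrightarrow> 0"
          unfolding tendsto_at_iff_sequentially using X0 X by (auto simp: o_def)
        moreover have "norm (q (x - y + X n) - q (x - y) - D (X n) (x - y)) / norm (X n) = norm (e (X n) y)" for n
        proof -
          have "x - y + X n = x + X n - y" by simp
          then show ?thesis by (simp only: e_def real_norm_def abs_divide abs_norm_cancel)
        qed
        ultimately show "(\<lambda>n. e (X n) y) \<longlonglongrightarrow> 0"
          by (simp add: tendsto_rabs_zero_iff)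
      qed
      fix n
      show "(\<lambda>y. newtonian_potential y * e (X n) y) \<in> borel_measurable lborel"
        unfolding e_def by measurable
      have "norm (newtonian_potential y * e (X n) y) \<le> ?w y" for y
      proof (cases "norm y \<le> R + B'")
        case True
        have "\<bar>q (x + X n - y) - q (x - y)\<bar> \<le> L * norm (X n)"
          using Lip[of "x - y" "X n"] by (simp add: algebra_simps)
        then have "\<bar>q (x + X n - y) - q (x - y) - D (X n) (x - y)\<bar> \<le> 2 * L * norm (X n)"
          using L[of "X n" "x - y"] by linarith
        then have "\<bar>e (X n) y\<bar> \<le> 2 * L" using nz[of n] by (simp add: e_def pos_divide_le_eq)
        then show ?thesis using True L0 by (auto simp: abs_mult intro!: mult_left_mono)
      next
        case False
        then have "q (x + X n - y) = 0" "q (x - y) = 0" "D (X n) (x - y) = 0"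
          using shifted_support[of R q, OF R(2) B'(1)[of n]] shifted_support[of R q, OF R(2) B'(2)]
            shifted_support[of R "D (X n)", OF D_supp B'(2)] by auto
        then show ?thesis by (simp add: e_def)
      qed
      then show "AE y in lborel. norm (newtonian_potential y * e (X n) y) \<le> ?w y" by simp
    qed simp
    then show "((\<lambda>h. \<bar>LINT y|lborel. newtonian_potential y * e h y\<bar>) \<circ> X) \<longlonglongrightarrow> 0"
      by (simp add: o_def tendsto_rabs_zero)
  qed
  moreover have "bounded_linear ?G"
    by (intro bounded_linear_sum bounded_linear_mult_const bounded_linear_inner_left)
  ultimately show ?thesis by (simp add: has_derivative_at D_def[abs_def])
qed

lemma Ck_on_newtonian_convolution:
  assumes q: "Ck_on (Suc 0) UNIV q" and R: "0 < R" "\<And>x. R < norm x \<Longrightarrow> q x = 0"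
  shows "Ck_on (Suc 0) UNIV (newtonian_convolution q)"
proof (rule Ck_on_SucI[OF open_UNIV has_derivative_newtonian_convolution[OF q R]])
  have D_supp: "frechet_derivative q (at z) i = 0" if "R < norm z" for i z
  proof -
    have "open {z :: real^3. R < norm z}" by (intro open_Collect_less continuous_intros)
    from frechet_derivative_cong_open[OF this, of z q "\<lambda>z. 0"] show ?thesis
      using that R(2) by simp
  qed
  have "continuous_on UNIV (newtonian_convolution (\<lambda>z. frechet_derivative q (at z) i))" for i
    by (rule continuous_on_newtonian_convolution[OF _ R(1)]) (use q D_supp in auto)
  then show "Ck_on 0 UNIV (\<lambda>x. \<Sum>i\<in>Basis. (u \<bullet> i) *
      newtonian_convolution (\<lambda>z. frechet_derivative q (at z) i) x)" for u
    by (auto intro!: continuous_intros)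
qed

section \<open>The flux of the Bernoulli function\<close>

lemma Ck_on_ln: "Ck_on k {0<..} (ln :: real \<Rightarrow> real)"
proof (cases k)
  case 0
  have "continuous_on {0<..} (ln :: real \<Rightarrow> real)" by (rule continuous_on_ln) auto
  then show ?thesis using 0 by simp
next
  case (Suc j)
  show ?thesis unfolding Suc
  proof (rule Ck_on_SucI[where f' = "\<lambda>r u. r powr (-1) * u"])
    fix r :: real assume "r \<in> {0<..}"
    then have "(ln has_real_derivative r powr (-1)) (at r)"
      by (auto intro!: derivative_eq_intros simp: powr_minus_divide)
    then show "(ln has_derivative (\<lambda>u. r powr (-1) * u)) (at r)"
      by (simp only: has_field_derivative_def)
  next
    show "Ck_on j {0<..} (\<lambda>r. r powr (-1) * u)" for u :: real
      by (intro Ck_on_mult Ck_on_powr Ck_on_const open_greaterThan)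
  qed simp
qed

lemma frechet_derivative_scaled:
  assumes "Ck_on (Suc 0) (- {0}) \<mu>" "c \<noteq> 0" "x \<noteq> 0"
  shows "frechet_derivative (\<lambda>x. \<mu> (c *\<^sub>R x)) (at x) h = c *\<^sub>R frechet_derivative \<mu> (at (c *\<^sub>R x)) h"
proof -
  have \<mu>: "(\<mu> has_derivative frechet_derivative \<mu> (at (c *\<^sub>R x))) (at (c *\<^sub>R x))"
    by (rule Ck_on_Suc_has_derivative[OF assms(1)]) (use assms in auto)
  have "((\<lambda>x. c *\<^sub>R x) has_derivative (\<lambda>h. c *\<^sub>R h)) (at x)"
    by (auto intro!: derivative_eq_intros)
  from frechet_derivative_at[OF has_derivative_compose[OF this \<mu>]]
  have "frechet_derivative (\<lambda>x. \<mu> (c *\<^sub>R x)) (at x) =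
      (\<lambda>h. frechet_derivative \<mu> (at (c *\<^sub>R x)) (c *\<^sub>R h))" by simp
  then show ?thesis
    using linear_cmul[OF bounded_linear.linear[OF has_derivative_bounded_linear[OF \<mu>]]] by simp
qed

lemma Ck_on_scaled:
  fixes \<mu> :: "'a::euclidean_space \<Rightarrow> 'b::real_normed_vector"
  assumes "Ck_on k (- {0}) \<mu>" "c \<noteq> 0"
  shows "Ck_on k (- {0}) (\<lambda>x. \<mu> (c *\<^sub>R x))"
proof (rule Ck_on_compose[where T = "- {0}"])
  show "Ck_on k (- {0}) (\<lambda>x :: 'a. c *\<^sub>R x)"
    by (rule Ck_on_bounded_linear) (auto intro: bounded_linear_scaleR_right)
qed (use assms in auto)

lemma continuous_on_frechet_derivative_apply:
  fixes \<theta> :: "'a::euclidean_space \<Rightarrow> real"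
  assumes "open S" "Ck_on (Suc 0) S \<theta>" "continuous_on S U"
  shows "continuous_on S (\<lambda>x. frechet_derivative \<theta> (at x) (U x))"
proof -
  have "frechet_derivative \<theta> (at x) (U x) =
      (\<Sum>i\<in>Basis. (U x \<bullet> i) *\<^sub>R frechet_derivative \<theta> (at x) i)" if "x \<in> S" for x
    by (rule linear_expand_Basis[OF bounded_linear.linear[OF has_derivative_bounded_linear[OF
            Ck_on_Suc_has_derivative[OF assms(2) that]]]])
  moreover have "continuous_on S (\<lambda>x. \<Sum>i\<in>Basis. (U x \<bullet> i) *\<^sub>R frechet_derivative \<theta> (at x) i)"
    using assms by (auto intro!: continuous_intros)
  ultimately show ?thesis by (simp cong: continuous_on_cong)
qed

text \<open>
  \<open>L(B)V\<close> is divergence-free for every \<open>L\<close>, so its flux does not depend on the scale of the cutoff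
  \<open>\<mu>\<close>.  For \<open>L(b) = b ln (b\<^sup>2 + \<delta>)\<close> the flux at scale \<open>1/2\<close> is, by homogeneity, the one at scale
  \<open>1\<close> with \<open>ln (b\<^sup>2 + \<delta>)\<close> replaced by \<open>ln (k b\<^sup>2 + \<delta>)\<close>, \<open>k = 2\<^sup>8\<^sup>/\<^sup>3\<close>; as \<open>\<delta> \<rightarrow> 0\<close> the difference
  of the two is \<open>ln k\<close> times the flux of \<open>B V\<close>.
\<close>

lemma homogeneous_flux_eq_0:
  fixes V :: "real^3 \<Rightarrow> real^3" and B \<mu> :: "real^3 \<Rightarrow> real"
  assumes V: "Ck_on (Suc 0) (- {0}) V" and B: "Ck_on (Suc 0) (- {0}) B"
    and homV: "\<And>c x. 0 < c \<Longrightarrow> V (c *\<^sub>R x) = c powr (- 2/3) *\<^sub>R V x"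
    and homB: "\<And>c x. 0 < c \<Longrightarrow> B (c *\<^sub>R x) = c powr (- 4/3) * B x"
    and div: "\<And>x. x \<noteq> 0 \<Longrightarrow> diverg V x = 0"
    and transport: "\<And>x. x \<noteq> 0 \<Longrightarrow> frechet_derivative B (at x) (V x) = 0"
    and \<mu>: "Ck_on (Suc 0) (- {0}) \<mu>" "\<And>x. norm x < 1 \<Longrightarrow> \<mu> x = 0" "\<And>x. 2 < norm x \<Longrightarrow> \<mu> x = 1"
  shows "integrable lborel (\<lambda>x. B x * frechet_derivative \<mu> (at x) (V x))"
    "(LINT x|lborel. B x * frechet_derivative \<mu> (at x) (V x)) = 0"
proof -
  \<comment> \<open>The integral of \<open>T\<close> is the flux of \<open>B V\<close> through a
    sphere smeared over the shell between radii 1 and 2. \<open>T\<close> vanishes outside this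
    shell, so multiplying it by any weight continuous off the origin keeps it integrable.\<close>
  define T where "T x = B x * frechet_derivative \<mu> (at x) (V x)" for x
  have opn: "open (- {0 :: real^3})" by auto
  have opn2: "open {x :: real^3. 2 < norm x}" by (intro open_Collect_less continuous_intros)
  have D0: "frechet_derivative \<mu> (at x) h = 0" if "norm x < 1 \<or> 2 < norm x" for x h
    using that frechet_derivative_cong_open[of "ball 0 1" x \<mu> "\<lambda>x. 0"] \<mu>(2)
      frechet_derivative_cong_open[OF opn2, of x \<mu> "\<lambda>x. 1"] \<mu>(3) by auto
  have T_off: "continuous_on (- {0}) T" unfolding T_def
    by (intro continuous_on_mult continuous_on_frechet_derivative_apply opn \<mu>(1)
        Ck_on_imp_continuous_on[OF B] Ck_on_imp_continuous_on[OF V])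
  have int: "continuous_on UNIV (\<lambda>x. T x * g x)" "integrable lborel (\<lambda>x. T x * g x)"
    if g: "continuous_on (- {0}) g" for g
  proof -
    have "continuous_on (- {0}) (\<lambda>x. T x * g x)" by (intro continuous_on_mult T_off g)
    then show "continuous_on UNIV (\<lambda>x. T x * g x)"
      by (rule continuous_on_UNIV_if_zero_near_0[where r = 1]) (auto simp: T_def D0)
    then show "integrable lborel (\<lambda>x. T x * g x)"
      by (rule integrable_continuous_compact_support[where R = 2]) (auto simp: T_def D0)
  qed
  have cB: "continuous_on (- {0}) B" by (rule Ck_on_imp_continuous_on[OF B])
  have pos: "0 < k * b\<^sup>2 + \<delta>" if "0 < \<delta>" "0 \<le> k" for k b \<delta> :: real
    using that by (intro add_nonneg_pos) auto
  have int_ln: "integrable lborel (\<lambda>x. T x * ln (k * (B x)\<^sup>2 + \<delta>))" if "0 < \<delta>" "0 \<le> k" for k \<delta>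
  proof (rule int(2))
    have "k * (B x)\<^sup>2 + \<delta> \<noteq> 0" for x using pos[OF that, of "B x"] by simp
    then show "continuous_on (- {0}) (\<lambda>x. ln (k * (B x)\<^sup>2 + \<delta>))"
      by (intro continuous_intros cB) auto
  qed
  \<comment> \<open>\<open>B\<close> has degree -4/3, so \<open>(B x)^2\<close> is
    \<open>2^(8/3)\<close> times \<open>(B (2 x))^2\<close>.\<close>
  define k :: real where "k = 2 powr (8/3)"
  have k: "1 < k" by (simp add: k_def)
  have scale: "(LINT x|lborel. T x * ln (k * (B x)\<^sup>2 + \<delta>)) = (LINT x|lborel. T x * ln ((B x)\<^sup>2 + \<delta>))"
    if \<delta>: "0 < \<delta>" for \<delta>
  proof -
    \<comment> \<open>Since \<open>\<delta>\<close> is positive, \<open>L\<close> is C^1 on the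
      whole line, including the zero \<open>b = 0\<close> that \<open>B\<close> may attain.\<close>
    define L where "L b = b * ln (b\<^sup>2 + \<delta>)" for b
    have L: "Ck_on (Suc 0) UNIV L"
    proof -
      have "Ck_on (Suc 0) UNIV (\<lambda>b. b\<^sup>2 + \<delta>)" unfolding power2_eq_square
        by (intro Ck_on_add Ck_on_mult Ck_on_const Ck_on_bounded_linear bounded_linear_ident open_UNIV)
      moreover have "range (\<lambda>b. b\<^sup>2 + \<delta>) \<subseteq> {0<..}" using pos[OF \<delta>, of 1] by auto
      ultimately have "Ck_on (Suc 0) UNIV (\<lambda>b. ln (b\<^sup>2 + \<delta>))"
        using Ck_on_compose[OF open_UNIV open_greaterThan _ Ck_on_ln] by blast
      then show ?thesis unfolding L_def
        by (intro Ck_on_mult[OF open_UNIV Ck_on_bounded_linear[OF open_UNIV bounded_linear_ident]])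
    qed
    \<comment> \<open>The difference of the cutoffs at scales 1 and 1/2 has support between radii
      1/2 and 2. Testing the divergence-free field \<open>L (B) V\<close> with it equates the two
      fluxes.\<close>
    define \<theta> where "\<theta> x = L (B x) * (\<mu> x - \<mu> (2 *\<^sub>R x))" for x
    have LB: "Ck_on (Suc 0) (- {0}) (\<lambda>x. L (B x))"
      by (rule Ck_on_compose[OF opn open_UNIV subset_UNIV L B])
    have \<mu>2: "Ck_on (Suc 0) (- {0}) (\<lambda>x. \<mu> (2 *\<^sub>R x))" by (rule Ck_on_scaled[OF \<mu>(1)]) simp
    have \<theta>: "Ck_on (Suc 0) (- {0}) \<theta>" unfolding \<theta>_def by (intro Ck_on_mult Ck_on_diff opn LB \<mu>(1) \<mu>2)
    \<comment> \<open>The factor 8 is \<open>2^(4/3) * 2^(2/3) * 2\<close>, from the degrees of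
      \<open>B\<close> and \<open>V\<close> and from the chain rule. It equals the Jacobian of
      doubling in dimension 3, so the change of variables below absorbs it; here the exponent 2/3 is
      decisive.\<close>
    have D\<theta>: "frechet_derivative \<theta> (at x) (V x) =
        T x * ln ((B x)\<^sup>2 + \<delta>) - 8 * (T (2 *\<^sub>R x) * ln (k * (B (2 *\<^sub>R x))\<^sup>2 + \<delta>))" if x: "x \<noteq> 0" for x
    proof -
      have x': "x \<in> - {0}" using x by simp
      have "frechet_derivative (\<lambda>x. L (B x)) (at x) =
          (\<lambda>h. frechet_derivative L (at (B x)) (frechet_derivative B (at x) h))"
        by (rule frechet_derivative_at[symmetric, OF has_derivative_compose[OF
                Ck_on_Suc_has_derivative[OF B x'] Ck_on_Suc_has_derivative[OF L UNIV_I]]])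
      moreover have "linear (frechet_derivative L (at (B x)))"
        by (rule bounded_linear.linear[OF has_derivative_bounded_linear[OF Ck_on_Suc_has_derivative[OF L UNIV_I]]])
      ultimately have LB0: "frechet_derivative (\<lambda>x. L (B x)) (at x) (V x) = 0"
        using transport[OF x] linear_0 by simp
      have "frechet_derivative \<theta> (at x) =
          (\<lambda>h. L (B x) * (frechet_derivative \<mu> (at x) h - frechet_derivative (\<lambda>x. \<mu> (2 *\<^sub>R x)) (at x) h) +
            frechet_derivative (\<lambda>x. L (B x)) (at x) h * (\<mu> x - \<mu> (2 *\<^sub>R x)))"
        unfolding \<theta>_def[abs_def]
        by (rule frechet_derivative_at[symmetric, OF has_derivative_mult[OF
                Ck_on_Suc_has_derivative[OF LB x'] has_derivative_diff[OF
                Ck_on_Suc_has_derivative[OF \<mu>(1) x'] Ck_on_Suc_has_derivative[OF \<mu>2 x']]]])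
      then have "frechet_derivative \<theta> (at x) (V x) = L (B x) * frechet_derivative \<mu> (at x) (V x)
          - L (B x) * (2 * frechet_derivative \<mu> (at (2 *\<^sub>R x)) (V x))"
        by (simp add: LB0 frechet_derivative_scaled[OF \<mu>(1) _ x] right_diff_distrib)
      moreover have "L (B x) * (2 * frechet_derivative \<mu> (at (2 *\<^sub>R x)) (V x)) =
          8 * (T (2 *\<^sub>R x) * ln (k * (B (2 *\<^sub>R x))\<^sup>2 + \<delta>))"
      proof -
        have Bx: "B x = 2 powr (4/3) * B (2 *\<^sub>R x)" "V x = 2 powr (2/3) *\<^sub>R V (2 *\<^sub>R x)"
          using homB[of 2 x] homV[of 2 x] by (simp_all flip: powr_add mult.assoc)
        have "linear (frechet_derivative \<mu> (at (2 *\<^sub>R x)))"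
          by (rule bounded_linear.linear[OF has_derivative_bounded_linear[OF Ck_on_Suc_has_derivative[OF \<mu>(1)]]])
            (use x in simp)
        then have "frechet_derivative \<mu> (at (2 *\<^sub>R x)) (V x) =
            2 powr (2/3) * frechet_derivative \<mu> (at (2 *\<^sub>R x)) (V (2 *\<^sub>R x))"
          unfolding Bx(2) by (simp add: linear_cmul)
        moreover have "(B x)\<^sup>2 = k * (B (2 *\<^sub>R x))\<^sup>2"
          unfolding Bx(1) power_mult_distrib by (simp add: k_def power2_eq_square flip: powr_add)
        moreover have "(2::real) powr (4/3) * (2 * 2 powr (2/3)) = 8"
        proof -
          have "(2::real) powr (4/3) * (2 * 2 powr (2/3)) = 2 powr (4/3) * (2 powr 1 * 2 powr (2/3))"
            by simp
          also have "\<dots> = 2 powr 3" unfolding powr_add[symmetric] by simp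
          finally show ?thesis by simp
        qed
        ultimately show ?thesis by (simp add: L_def T_def Bx(1))
      qed
      ultimately show ?thesis by (simp add: L_def T_def)
    qed
    let ?g1 = "\<lambda>x. T x * ln (1 * (B x)\<^sup>2 + \<delta>)" and ?g2 = "\<lambda>x. T x * ln (k * (B x)\<^sup>2 + \<delta>)"
    have g1: "integrable lborel ?g1" by (rule int_ln[OF \<delta>]) simp
    have g2: "integrable lborel ?g2" by (rule int_ln[OF \<delta>]) (use k in simp)
    have g2m: "?g2 \<in> borel_measurable borel" using borel_measurable_integrable[OF g2] by simp
    have g2s: "integrable lborel (\<lambda>x. ?g2 (0 + 2 *\<^sub>R x))"
    proof (rule integrable_continuous_compact_support[where R = 2])
      have "k * (B x)\<^sup>2 + \<delta> \<noteq> 0" for x using pos[OF \<delta>, of k "B x"] k by simp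
      then have "continuous_on UNIV ?g2" by (intro int(1) continuous_intros cB) auto
      then show "continuous_on UNIV (\<lambda>x. ?g2 (0 + 2 *\<^sub>R x))"
        by (rule continuous_on_compose2) (auto intro!: continuous_intros)
    qed (simp add: T_def D0)
    have "(LINT x|lborel. frechet_derivative \<theta> (at x) (V x)) = 0"
    proof (rule integral_transport_eq_0[OF \<theta> V div, where r = "1/2" and R = 2])
      fix x :: "real^3"
      show "\<theta> x = 0" if "norm x < 1/2" using that by (simp add: \<theta>_def \<mu>(2))
      show "\<theta> x *\<^sub>R V x = 0" if "2 < norm x" using that by (simp add: \<theta>_def \<mu>(3))
    qed simp_all
    moreover have "frechet_derivative \<theta> (at x) (V x) = ?g1 x - 8 * ?g2 (0 + 2 *\<^sub>R x)" for x
    proof (cases "x = 0")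
      case True
      have "frechet_derivative \<theta> (at 0) = frechet_derivative (\<lambda>x. 0) (at 0)"
        by (rule frechet_derivative_cong_open[of "ball 0 (1/2)"]) (auto simp: \<theta>_def \<mu>(2))
      then show ?thesis using True by (simp add: T_def D0)
    qed (simp add: D\<theta>)
    ultimately have "(LINT x|lborel. ?g1 x) = 8 * (LINT x|lborel. ?g2 (0 + 2 *\<^sub>R x))"
      using g1 g2s by simp
    also have "\<dots> = (LINT x|lborel. ?g2 x)"
      using lborel_integral_affine[OF g2m, of 2 0] by simp
    finally show ?thesis by simp
  qed
  define d where "d n = 1 / real (Suc n)" for n
  have d: "0 < d n" for n by (simp add: d_def)
  define s where "s n x = T x * (ln (k * (B x)\<^sup>2 + d n) - ln ((B x)\<^sup>2 + d n))" for n x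
  have T_int: "integrable lborel T" using int(2)[of "\<lambda>x. 1"] by simp
  then have [measurable]: "T \<in> borel_measurable lborel" by simp
  have s_int: "integrable lborel (s n)" and s0: "(LINT x|lborel. s n x) = 0" for n
    using int_ln[OF d[of n], of k] int_ln[OF d[of n], of 1] scale[OF d[of n]] k
    by (simp_all add: s_def[abs_def] right_diff_distrib)
  have "(\<lambda>n. LINT x|lborel. s n x) \<longlonglongrightarrow> (LINT x|lborel. T x * ln k)"
  proof (rule integral_dominated_convergence[where s = s and w = "\<lambda>x. \<bar>T x\<bar> * ln k"])
    show "integrable lborel (\<lambda>x. \<bar>T x\<bar> * ln k)" using T_int by simp
    show "s n \<in> borel_measurable lborel" for n using s_int by simp
    show "AE x in lborel. (\<lambda>n. s n x) \<longlonglongrightarrow> T x * ln k"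
    proof (intro always_eventually allI)
      fix x
      show "(\<lambda>n. s n x) \<longlonglongrightarrow> T x * ln k"
      \<comment> \<open>Where \<open>B\<close> vanishes the difference of logarithms is 0 instead of
        tending to \<open>ln k\<close>, but the factor \<open>B\<close> in \<open>T\<close> makes
        both sides 0.\<close>
      proof (cases "B x = 0")
        case True
        then show ?thesis by (simp add: s_def T_def)
      next
        case False
        have d0: "d \<longlonglongrightarrow> 0"
          using LIMSEQ_inverse_real_of_nat by (simp add: d_def[abs_def] divide_inverse)
        have "(\<lambda>n. T x * (ln (k * (B x)\<^sup>2 + d n) - ln ((B x)\<^sup>2 + d n))) \<longlonglongrightarrow>
            T x * (ln (k * (B x)\<^sup>2 + 0) - ln ((B x)\<^sup>2 + 0))"
          using False k by (intro tendsto_intros d0) auto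
        then show ?thesis using False k by (simp add: s_def ln_mult)
      qed
    qed
    fix n
    \<comment> \<open>Since \<open>k > 1\<close>, \<open>b^2 + \<delta> \<le> k b^2 + \<delta> \<le>
      k (b^2 + \<delta>)\<close>, so the difference of logarithms lies between 0 and
      \<open>ln k\<close> whatever \<open>\<delta>\<close> is.\<close>
    have "norm (s n x) \<le> \<bar>T x\<bar> * ln k" for x
    proof -
      have p: "0 < (B x)\<^sup>2 + d n" using d[of n] by (intro add_nonneg_pos) auto
      have "ln ((B x)\<^sup>2 + d n) \<le> ln (k * (B x)\<^sup>2 + d n)"
        using p k mult_right_mono[of 1 k "(B x)\<^sup>2"] by (subst ln_le_cancel_iff) auto
      moreover have "ln (k * (B x)\<^sup>2 + d n) \<le> ln (k * ((B x)\<^sup>2 + d n))"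
      proof (subst ln_le_cancel_iff)
        show "0 < k * (B x)\<^sup>2 + d n" using pos[OF d[of n], of k "B x"] k by simp
        show "0 < k * ((B x)\<^sup>2 + d n)" using p k by (intro mult_pos_pos) auto
        show "k * (B x)\<^sup>2 + d n \<le> k * ((B x)\<^sup>2 + d n)"
          using mult_right_mono[of 1 k "d n"] d[of n] k by (simp add: distrib_left)
      qed
      moreover have "ln (k * ((B x)\<^sup>2 + d n)) = ln k + ln ((B x)\<^sup>2 + d n)"
        using p k by (intro ln_mult_pos) auto
      ultimately show ?thesis by (auto simp: s_def abs_mult intro!: mult_left_mono)
    qed
    then show "AE x in lborel. norm (s n x) \<le> \<bar>T x\<bar> * ln k" by simp
  qed measurable
  then have "(LINT x|lborel. T x) * ln k = 0" by (simp add: s0 LIMSEQ_const_iff)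
  then show "integrable lborel (\<lambda>x. B x * frechet_derivative \<mu> (at x) (V x))"
    "(LINT x|lborel. B x * frechet_derivative \<mu> (at x) (V x)) = 0"
    using k T_int by (simp_all add: T_def[abs_def])
qed

text \<open>The Jacobian and the two degrees combine to
  \<open>c^3 * c^(-4/3) * c^(-2/3) = c\<close>, which is the chain-rule factor of the rescaled
  cutoff. Vanishing at one scale thus passes to all, in particular to arbitrarily small smeared
  spheres.\<close>

lemma homogeneous_flux_scaled_eq_0:
  fixes V :: "real^3 \<Rightarrow> real^3" and B \<mu> :: "real^3 \<Rightarrow> real"
  assumes homV: "\<And>c x. 0 < c \<Longrightarrow> V (c *\<^sub>R x) = c powr (- 2/3) *\<^sub>R V x"
    and homB: "\<And>c x. 0 < c \<Longrightarrow> B (c *\<^sub>R x) = c powr (- 4/3) * B x"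
    and \<mu>: "Ck_on (Suc 0) (- {0}) \<mu>" "\<And>x. norm x < 1 \<Longrightarrow> \<mu> x = 0"
    and int: "(\<lambda>x. B x * frechet_derivative \<mu> (at x) (V x)) \<in> borel_measurable borel"
      "(LINT x|lborel. B x * frechet_derivative \<mu> (at x) (V x)) = 0"
    and c: "0 < c"
  shows "(LINT x|lborel. B x * frechet_derivative (\<lambda>x. \<mu> (c *\<^sub>R x)) (at x) (V x)) = 0"
proof -
  let ?T = "\<lambda>x. B x * frechet_derivative \<mu> (at x) (V x)"
  have "B x * frechet_derivative (\<lambda>x. \<mu> (c *\<^sub>R x)) (at x) (V x) = c ^ 3 * ?T (0 + c *\<^sub>R x)" for x
  proof (cases "x = 0")
    case True
    have "frechet_derivative (\<lambda>x. \<mu> (c *\<^sub>R x)) (at 0) = frechet_derivative (\<lambda>x. 0) (at 0)"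
      by (rule frechet_derivative_cong_open[of "ball 0 (1/c)"])
        (use c in \<open>auto simp: \<mu>(2) field_simps\<close>)
    moreover have "frechet_derivative \<mu> (at 0) = frechet_derivative (\<lambda>x. 0) (at 0)"
      by (rule frechet_derivative_cong_open[of "ball 0 1"]) (auto simp: \<mu>(2))
    ultimately show ?thesis using True by simp
  next
    case False
    have "linear (frechet_derivative \<mu> (at (c *\<^sub>R x)))"
      by (rule bounded_linear.linear[OF has_derivative_bounded_linear[OF Ck_on_Suc_has_derivative[OF \<mu>(1)]]])
        (use False c in simp)
    then have "c ^ 3 * ?T (0 + c *\<^sub>R x) =
        c ^ 3 * (c powr (- 4/3) * c powr (- 2/3)) * (B x * frechet_derivative \<mu> (at (c *\<^sub>R x)) (V x))"
      by (simp add: homB[OF c] homV[OF c] linear_cmul)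
    also have "c ^ 3 * (c powr (- 4/3) * c powr (- 2/3)) = c"
    proof -
      have "c ^ 3 * (c powr (- 4/3) * c powr (- 2/3)) = c powr 3 * (c powr (- 4/3) * c powr (- 2/3))"
        using c by (simp add: powr_numeral)
      also have "\<dots> = c powr 1" unfolding powr_add[symmetric] by simp
      finally show ?thesis using c by simp
    qed
    finally show ?thesis using False c by (simp add: frechet_derivative_scaled[OF \<mu>(1)])
  qed
  then have "(LINT x|lborel. B x * frechet_derivative (\<lambda>x. \<mu> (c *\<^sub>R x)) (at x) (V x)) =
      c ^ 3 * (LINT x|lborel. ?T (0 + c *\<^sub>R x))" by simp
  also have "\<dots> = (LINT x|lborel. ?T x)"
    using lborel_integral_affine[OF int(1), of c 0] c by simp
  finally show ?thesis using int(2) by simp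
qed

section \<open>Vanishing of the flux\<close>

text \<open>Differentiating half the square of \<open>W\<close> along \<open>W\<close> gives the
  advection term paired with \<open>W\<close>. For the Euler solution this says that
  \<open>B\<close> is transported; for the tapered flow it exhibits the power of the force as a
  derivative along the velocity.\<close>

lemma frechet_derivative_Bernoulli:
  assumes "W differentiable (at x)" "p differentiable (at x)"
  shows "frechet_derivative (\<lambda>y. W y \<bullet> W y / 2 + p y) (at x) (W x) = (advect W x + grad p x) \<bullet> W x"
proof -
  note W = frechet_derivative_works[THEN iffD1, OF assms(1)]
  note p = frechet_derivative_works[THEN iffD1, OF assms(2)]
  have "((\<lambda>y. 1 / 2 * (W y \<bullet> W y) + p y) has_derivative
      (\<lambda>h. 1 / 2 * (W x \<bullet> frechet_derivative W (at x) h + frechet_derivative W (at x) h \<bullet> W x)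
        + frechet_derivative p (at x) h)) (at x)"
    by (intro has_derivative_add has_derivative_mult_right has_derivative_inner W p)
  from frechet_derivative_at[OF this, symmetric] show ?thesis
    by (simp add: inner_add_left grad_inner[OF assms(2)] advect_eq_frechet_derivative[OF assms(1)]
        inner_commute[of "W x" "frechet_derivative W (at x) (W x)"])
qed

text \<open>
  \<open>DG(U)\<close> is tested against the cutoffs \<open>\<mu>\<^sub>n(x) = \<mu>((n + 3) x)\<close>; the boundary term splits into the
  flux of \<open>B V\<close>, which vanishes, and that of \<open>P\<^sub>0 V\<close>, which is dominated by \<open>C \<bar>x\<bar>\<^sup>-\<^sup>2\<close> and tends to
  \<open>0\<close> pointwise.
\<close>

lemma tapered_flux_eq_0:
  fixes V U :: "real^3 \<Rightarrow> real^3" and B G P0 \<mu> :: "real^3 \<Rightarrow> real"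
  assumes V: "Ck_on (Suc 0) (- {0}) V" and B: "Ck_on (Suc 0) (- {0}) B"
    and homV: "\<And>c x. 0 < c \<Longrightarrow> V (c *\<^sub>R x) = c powr (- 2/3) *\<^sub>R V x"
    and homB: "\<And>c x. 0 < c \<Longrightarrow> B (c *\<^sub>R x) = c powr (- 4/3) * B x"
    and divV: "\<And>x. x \<noteq> 0 \<Longrightarrow> diverg V x = 0"
    and transport: "\<And>x. x \<noteq> 0 \<Longrightarrow> frechet_derivative B (at x) (V x) = 0"
    and \<mu>: "Ck_on (Suc 0) (- {0}) \<mu>" "\<And>x. norm x < 1 \<Longrightarrow> \<mu> x = 0" "\<And>x. 2 < norm x \<Longrightarrow> \<mu> x = 1"
    and U: "Ck_on (Suc 0) (- {0}) U" and divU: "\<And>x. x \<noteq> 0 \<Longrightarrow> diverg U x = 0"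
    and U_supp: "\<And>x. 2 < norm x \<Longrightarrow> U x = 0"
    and UV: "\<And>x. x \<noteq> 0 \<Longrightarrow> norm x < 1 \<Longrightarrow> U x = V x"
    and P0: "Ck_on (Suc 0) UNIV P0" and G: "Ck_on (Suc 0) (- {0}) G"
    and GB: "\<And>x. x \<noteq> 0 \<Longrightarrow> norm x < 1 \<Longrightarrow> G x = B x + P0 x"
  shows "integrable lborel (\<lambda>x. frechet_derivative G (at x) (U x))"
    "(LINT x|lborel. frechet_derivative G (at x) (U x)) = 0"
proof -
  define J where "J x = frechet_derivative G (at x) (U x)" for x
  have opn: "open (- {0 :: real^3})" by auto
  have cV: "continuous_on (- {0}) V" and cU: "continuous_on (- {0}) U"
    and cB: "continuous_on (- {0}) B" and cG: "continuous_on (- {0}) G"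
    using V U B G Ck_on_imp_continuous_on by blast+
  have lin: "linear (frechet_derivative \<theta> (at x))" if "Ck_on (Suc 0) S \<theta>" "x \<in> S"
    for S and \<theta> :: "real^3 \<Rightarrow> real" and x
    by (rule bounded_linear.linear[OF has_derivative_bounded_linear[OF Ck_on_Suc_has_derivative[OF that]]])

  \<comment> \<open>Homogeneity gives the exponent -2/3, weakened here to -1: the derivative of the
    cutoff will contribute another \<open>1 / norm x\<close>, and the product is the integrable
    inverse square.\<close>
  obtain C where C: "0 \<le> C" "\<And>x. x \<noteq> 0 \<Longrightarrow> norm x \<le> 1 \<Longrightarrow> norm (V x) \<le> C / norm x"
  proof -
    have "compact (V ` sphere 0 1)"
      by (rule compact_continuous_image) (auto intro: continuous_on_subset[OF cV])
    then have "bounded (V ` sphere 0 1)" by (rule compact_imp_bounded)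
    then obtain C where C: "0 < C" "\<And>y. y \<in> sphere 0 1 \<Longrightarrow> norm (V y) \<le> C"
      by (auto simp: bounded_pos)
    have "norm (V x) \<le> C / norm x" if x: "x \<noteq> 0" "norm x \<le> 1" for x
    proof -
      have "V x = V (norm x *\<^sub>R sgn x)" using x by (simp add: sgn_div_norm)
      also have "\<dots> = norm x powr (- 2/3) *\<^sub>R V (sgn x)" using x by (intro homV) simp
      finally have "norm (V x) = norm x powr (- 2/3) * norm (V (sgn x))" by simp
      also have "\<dots> \<le> norm x powr (- 1) * C"
        using x C(2)[of "sgn x"] by (intro mult_mono powr_mono') (auto simp: norm_sgn)
      finally show ?thesis using x by (simp add: powr_minus_divide)
    qed
    then show ?thesis using C(1) by (intro that[of C]) auto
  qed
  obtain LP where LP: "0 \<le> LP" "\<And>x h. norm x \<le> 1 \<Longrightarrow> \<bar>frechet_derivative P0 (at x) h\<bar> \<le> LP * norm h"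
    using frechet_derivative_bounded_on_compact[OF P0 _ subset_UNIV, of "cball 0 1"] by auto
  obtain MP where MP: "0 \<le> MP" "\<And>x. norm x \<le> 1 \<Longrightarrow> \<bar>P0 x\<bar> \<le> MP"
  proof -
    have "compact (P0 ` cball 0 1)"
      by (rule compact_continuous_image)
        (auto intro: continuous_on_subset[OF Ck_on_imp_continuous_on[OF P0]])
    then have "bounded (P0 ` cball 0 1)" by (rule compact_imp_bounded)
    then obtain M where "0 < M" "\<And>x. norm x \<le> 1 \<Longrightarrow> \<bar>P0 x\<bar> \<le> M" by (auto simp: bounded_pos)
    then show ?thesis by (intro that[of M]) auto
  qed

  \<comment> \<open>Integrability of the flux density\<close>
  have J_off: "continuous_on (- {0}) J"
    unfolding J_def by (intro continuous_on_frechet_derivative_apply opn G cU)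
  have J_supp: "J x = 0" if "2 < norm x" for x
  proof -
    have "x \<in> - {0}" using that by auto
    from linear_0[OF lin[OF G this]] show ?thesis by (simp add: J_def U_supp[OF that])
  qed
  \<comment> \<open>Transport removes the contribution of \<open>B\<close>. The derivative of
    \<open>P0\<close> is bounded, so \<open>J\<close> is no more singular at the origin than
    \<open>V\<close>.\<close>
  have J_near: "J x = frechet_derivative P0 (at x) (V x)" if x: "x \<noteq> 0" "norm x < 1" for x
  proof -
    have x': "x \<in> - {0}" using x by simp
    have "frechet_derivative G (at x) = frechet_derivative (\<lambda>y. B y + P0 y) (at x)"
      by (rule frechet_derivative_cong_open[of "ball 0 1 - {0}"]) (use x GB in auto)
    also have "\<dots> = (\<lambda>h. frechet_derivative B (at x) h + frechet_derivative P0 (at x) h)"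
      by (rule frechet_derivative_at[symmetric, OF has_derivative_add[OF
              Ck_on_Suc_has_derivative[OF B x'] Ck_on_Suc_has_derivative[OF P0 UNIV_I]]])
    finally show ?thesis using UV[OF x] transport[OF x(1)] by (simp add: J_def)
  qed
  obtain K where K: "0 \<le> K" "\<And>x. 1 \<le> norm x \<Longrightarrow> norm x \<le> 2 \<Longrightarrow> \<bar>J x\<bar> \<le> K"
  proof -
    have "compact (J ` (cball 0 2 - ball 0 1))"
      by (rule compact_continuous_image)
        (auto intro!: continuous_on_subset[OF J_off] compact_diff)
    then have "bounded (J ` (cball 0 2 - ball 0 1))" by (rule compact_imp_bounded)
    then obtain K where K: "0 < K" "\<And>x. x \<in> cball 0 2 - ball 0 1 \<Longrightarrow> \<bar>J x\<bar> \<le> K"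
      by (auto simp: bounded_pos)
    then show ?thesis by (intro that[of K]) auto
  qed
  have J_int: "integrable lborel J"
  \<comment> \<open>The 4 bounds \<open>(norm x)^2\<close> on the shell between radii 1 and 2, where
    \<open>J\<close> is at most \<open>K\<close>.\<close>
  proof (rule integrable_bound_inverse_square[where R = 2 and C = "max (LP * C) (4 * K)"])
    show "J \<in> borel_measurable borel" by (rule borel_measurable_continuous_off_0[OF J_off])
    fix x :: "real^3" assume x: "x \<noteq> 0" "norm x \<le> 2"
    show "\<bar>J x\<bar> \<le> max (LP * C) (4 * K) / (norm x)\<^sup>2"
    proof (cases "norm x < 1")
      case True
      have "\<bar>J x\<bar> \<le> LP * norm (V x)" using J_near[OF x(1) True] LP True by simp
      also have "\<dots> \<le> LP * (C / norm x)" using C LP x True by (intro mult_left_mono) auto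
      also have "\<dots> = LP * C * norm x / (norm x)\<^sup>2" using x by (simp add: power2_eq_square)
      also have "\<dots> \<le> LP * C / (norm x)\<^sup>2"
        using True LP C by (intro divide_right_mono mult_left_le) auto
      also have "\<dots> \<le> max (LP * C) (4 * K) / (norm x)\<^sup>2" by (intro divide_right_mono) auto
      finally show ?thesis .
    next
      case False
      have "(norm x)\<^sup>2 \<le> 2\<^sup>2" using x by (intro power_mono) auto
      then have "K * (norm x)\<^sup>2 \<le> K * 4" using K by (intro mult_left_mono) auto
      then have "K \<le> 4 * K / (norm x)\<^sup>2" using x by (simp add: field_simps)
      also have "\<dots> \<le> max (LP * C) (4 * K) / (norm x)\<^sup>2" by (intro divide_right_mono) auto
      finally show ?thesis using K(2)[of x] x False by simp
    qed
  qed (use J_supp in auto)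

  \<comment> \<open>The transition region of the rescaled cutoff lies between the radii
    \<open>1 / c n\<close> and \<open>2 / c n\<close>. It has to stay inside the unit ball, where
    \<open>U = V\<close> and \<open>G = B + P0\<close>; \<open>c n \<ge> 3\<close> keeps it within
    radius 2/3.\<close>
  define c where "c n = real n + 3" for n
  have c: "0 < c n" "3 \<le> c n" for n by (auto simp: c_def)
  define m where "m n x = \<mu> (c n *\<^sub>R x)" for n x
  have m: "Ck_on (Suc 0) (- {0}) (m n)" for n
    unfolding m_def by (rule Ck_on_scaled[OF \<mu>(1)]) (use c[of n] in simp)
  have m0: "m n x = 0" if "norm x < 1 / c n" for n x
    using that c(1)[of n] by (auto simp: m_def field_simps intro!: \<mu>(2))
  have m1: "m n x = 1" if "2 < c n * norm x" for n x
    using that c(1)[of n] by (auto simp: m_def intro!: \<mu>(3))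
  have Dm: "frechet_derivative (m n) (at x) h = 0" if "norm x < 1 / c n \<or> 2 < c n * norm x" for n x h
    using that
  proof
    assume "norm x < 1 / c n"
    then have "frechet_derivative (m n) (at x) = frechet_derivative (\<lambda>x. 0) (at x)"
      by (intro frechet_derivative_cong_open[of "ball 0 (1 / c n)"]) (auto simp: m0)
    then show ?thesis by simp
  next
    have "open {x :: real^3. 2 < c n * norm x}" by (intro open_Collect_less continuous_intros)
    moreover assume "2 < c n * norm x"
    ultimately have "frechet_derivative (m n) (at x) = frechet_derivative (\<lambda>x. 1) (at x)"
      by (intro frechet_derivative_cong_open[of "{x. 2 < c n * norm x}"]) (auto simp: m1)
    then show ?thesis by simp
  qed
  have small: "norm x < 1" if "c n * norm x \<le> 2" for n x
  proof -
    have "3 * norm x \<le> c n * norm x" using c(2) by (intro mult_right_mono) auto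
    then show ?thesis using that by linarith
  qed
  have far: "\<forall>\<^sub>F n in sequentially. 2 < c n * norm x" if "x \<noteq> 0" for x :: "real^3"
  proof -
    obtain N where N: "2 / norm x < real N" using reals_Archimedean2 by blast
    have "2 < c n * norm x" if "n \<ge> N" for n
    proof -
      have "2 < real N * norm x" using N \<open>x \<noteq> 0\<close> by (simp add: field_simps)
      also have "\<dots> \<le> c n * norm x" using that by (intro mult_right_mono) (auto simp: c_def)
      finally show ?thesis .
    qed
    then show ?thesis unfolding eventually_sequentially by blast
  qed

  obtain M\<mu> where M\<mu>: "0 \<le> M\<mu>" "\<And>x. \<bar>\<mu> x\<bar> \<le> M\<mu>"
  proof -
    have "continuous_on UNIV \<mu>"
      by (rule continuous_on_UNIV_if_zero_near_0[where r = 1, OF Ck_on_imp_continuous_on[OF \<mu>(1)]])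
        (auto simp: \<mu>(2))
    \<comment> \<open>\<open>\<mu>\<close> is 1 far out, so compactness is applied to
      \<open>1 - \<mu>\<close>.\<close>
    then have "continuous_on UNIV (\<lambda>x. 1 - \<mu> x)" by (intro continuous_intros)
    then obtain M where M: "0 \<le> M" "\<And>x. \<bar>1 - \<mu> x\<bar> \<le> M"
      by (rule continuous_compact_support_bounded[where R = 2]) (auto simp: \<mu>(3))
    have "\<bar>\<mu> x\<bar> \<le> M + 1" for x using M(2)[of x] by linarith
    then show ?thesis using M(1) by (intro that[of "M + 1"]) auto
  qed
  obtain L\<mu> where L\<mu>: "0 \<le> L\<mu>"
    "\<And>x h. 1 \<le> norm x \<Longrightarrow> norm x \<le> 2 \<Longrightarrow> \<bar>frechet_derivative \<mu> (at x) h\<bar> \<le> L\<mu> * norm h"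
  proof -
    obtain L where L: "0 \<le> L" "\<And>x h. x \<in> cball 0 2 - ball 0 1 \<Longrightarrow>
        \<bar>frechet_derivative \<mu> (at x) h\<bar> \<le> L * norm h"
      by (rule frechet_derivative_bounded_on_compact[OF \<mu>(1), of "cball 0 2 - ball 0 1"])
        (auto intro: compact_diff)
    then show ?thesis by (intro that[of L]) auto
  qed

  define E where "E n x = P0 x * frechet_derivative (m n) (at x) (V x)" for n x
  have E_bound: "\<bar>E n x\<bar> \<le> 2 * MP * L\<mu> * C * (indicator (cball 0 1) x / (norm x)\<^sup>2)" if x: "x \<noteq> 0" for n x
  proof (cases "norm x < 1 / c n \<or> 2 < c n * norm x")
    case True
    then show ?thesis using MP L\<mu> C by (simp add: E_def Dm)
  next
    case False
    then have r: "1 \<le> c n * norm x" "c n * norm x \<le> 2" using c(1)[of n] by (auto simp: field_simps)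
    have x1: "norm x < 1" by (rule small[OF r(2)])
    have "\<bar>frechet_derivative (m n) (at x) (V x)\<bar> = c n * \<bar>frechet_derivative \<mu> (at (c n *\<^sub>R x)) (V x)\<bar>"
      unfolding m_def[abs_def] using c[of n] x by (simp add: frechet_derivative_scaled[OF \<mu>(1)] abs_mult)
    also have "\<dots> \<le> c n * (L\<mu> * norm (V x))"
      using c(1)[of n] r by (intro mult_left_mono L\<mu>) auto
    \<comment> \<open>On the transition region \<open>c n \<le> 2 / norm x\<close>, which trades the
      growing factor \<open>c n\<close> for a bound independent of \<open>n\<close>.\<close>
    also have "\<dots> \<le> 2 / norm x * (L\<mu> * (C / norm x))"
      using c(1)[of n] r C L\<mu> x x1 by (intro mult_mono) (auto simp: field_simps)
    finally have "\<bar>P0 x\<bar> * \<bar>frechet_derivative (m n) (at x) (V x)\<bar> \<le> MP * (2 / norm x * (L\<mu> * (C / norm x)))"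
      using MP x1 by (intro mult_mono) auto
    then show ?thesis using x1 by (simp add: E_def abs_mult power2_eq_square mult_ac)
  qed
  have E_meas: "E n \<in> borel_measurable borel" for n
    unfolding E_def[abs_def]
    by (intro borel_measurable_continuous_off_0 continuous_on_mult continuous_on_frechet_derivative_apply
        opn m cV continuous_on_subset[OF Ck_on_imp_continuous_on[OF P0]]) auto
  have E_dom: "integrable lborel (\<lambda>x::real^3. 2 * MP * L\<mu> * C * (indicator (cball 0 1) x / (norm x)\<^sup>2))"
    by (intro integrable_mult_right integrable_inverse_square_cball) simp
  have E_AE: "AE x in lborel. norm (E n x) \<le> 2 * MP * L\<mu> * C * (indicator (cball 0 1) x / (norm x)\<^sup>2)" for n
    using AE_lborel_singleton[of "0 :: real^3"] by eventually_elim (use E_bound in auto)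
  have E_lim_AE: "AE x in lborel. (\<lambda>n. E n x) \<longlonglongrightarrow> 0"
    using AE_lborel_singleton[of "0 :: real^3"]
  proof eventually_elim
    case (elim x)
    from far[OF elim] have "\<forall>\<^sub>F n in sequentially. E n x = 0"
      by eventually_elim (simp add: E_def Dm)
    then show ?case by (rule tendsto_eventually)
  qed
  have E_lim: "(\<lambda>n. LINT x|lborel. E n x) \<longlonglongrightarrow> (LINT x :: real^3|lborel. (0::real))"
    by (rule integral_dominated_convergence[where s = E, OF _ _ E_dom E_lim_AE E_AE])
      (use E_meas in auto)
  have E_int: "integrable lborel (E n)" for n
    by (rule integrable_dominated_convergence2[where s = E, OF _ _ E_dom E_lim_AE E_AE])
      (use E_meas in auto)

  \<comment> \<open>The flux density tested against the shrinking cutoffs\<close>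
  note flux = homogeneous_flux_eq_0[OF V B homV homB divV transport \<mu>]
  have flux_meas: "(\<lambda>x. B x * frechet_derivative \<mu> (at x) (V x)) \<in> borel_measurable borel"
    using borel_measurable_integrable[OF flux(1)] by simp
  have flux_c: "(LINT x|lborel. B x * frechet_derivative (m n) (at x) (V x)) = 0" for n
    unfolding m_def[abs_def]
    by (rule homogeneous_flux_scaled_eq_0[OF homV homB \<mu>(1,2) flux_meas flux(2) c(1)])
  have mJ: "(LINT x|lborel. m n x * J x) = - (LINT x|lborel. E n x)"
    and mJ_int: "integrable lborel (\<lambda>x. m n x * J x)" for n
  proof -
    define \<theta> where "\<theta> x = m n x * G x" for x
    have \<theta>: "Ck_on (Suc 0) (- {0}) \<theta>" unfolding \<theta>_def by (intro Ck_on_mult opn m G)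
    have r: "0 < 1 / c n" using c by simp
    have \<theta>0: "\<theta> x = 0" if "norm x < 1 / c n" for x using that by (simp add: \<theta>_def m0)
    have \<theta>R: "\<theta> x *\<^sub>R U x = 0" if "2 < norm x" for x using that by (simp add: U_supp)
    note tr = integral_transport_eq_0[OF \<theta> U divU r \<theta>0 \<theta>R]
    have near0: "continuous_on UNIV (\<lambda>x. m n x * J x)"
      by (rule continuous_on_UNIV_if_zero_near_0[OF _ r])
        (auto simp: m0 intro!: continuous_on_mult J_off Ck_on_imp_continuous_on[OF m])
    show I1: "integrable lborel (\<lambda>x. m n x * J x)"
      by (rule integrable_continuous_compact_support[OF near0, where R = 2]) (simp add: J_supp)
    have I2: "integrable lborel (\<lambda>x. B x * frechet_derivative (m n) (at x) (V x))"
    proof (rule integrable_continuous_compact_support[where R = 1])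
      show "continuous_on UNIV (\<lambda>x. B x * frechet_derivative (m n) (at x) (V x))"
        by (rule continuous_on_UNIV_if_zero_near_0[OF _ r])
          (auto simp: Dm intro!: continuous_on_mult cB continuous_on_frechet_derivative_apply m cV)
      fix x :: "real^3" assume "1 < norm x"
      then have "2 < c n * norm x" using small[of n x] by (meson less_asym not_le)
      then show "B x * frechet_derivative (m n) (at x) (V x) = 0" by (simp add: Dm)
    qed
    have split: "frechet_derivative \<theta> (at x) (U x) =
        m n x * J x + B x * frechet_derivative (m n) (at x) (V x) + E n x" for x
    proof (cases "x = 0")
      case True
      have "frechet_derivative \<theta> (at 0) = frechet_derivative (\<lambda>x. 0) (at 0)"
        by (rule frechet_derivative_cong_open[of "ball 0 (1 / c n)"]) (use \<theta>0 c in auto)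
      then show ?thesis using True m0[of 0 n] Dm[of 0 n] c(1)[of n] by (simp add: E_def)
    next
      case False
      then have x': "x \<in> - {0}" by simp
      have "frechet_derivative \<theta> (at x) =
          (\<lambda>h. m n x * frechet_derivative G (at x) h + frechet_derivative (m n) (at x) h * G x)"
        unfolding \<theta>_def[abs_def]
        by (rule frechet_derivative_at[symmetric, OF has_derivative_mult[OF
                Ck_on_Suc_has_derivative[OF m x'] Ck_on_Suc_has_derivative[OF G x']]])
      \<comment> \<open>Either \<open>x\<close> is beyond the transition region and both sides
        vanish with the derivative of the cutoff, or \<open>x\<close> is in the unit ball, where
        \<open>G\<close> splits into \<open>B\<close> and \<open>P0\<close>.\<close>
      moreover have "frechet_derivative (m n) (at x) (U x) * G x =
          B x * frechet_derivative (m n) (at x) (V x) + E n x"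
      proof (cases "2 < c n * norm x")
        case True
        then show ?thesis by (simp add: Dm E_def)
      next
        case far: False
        then have "norm x < 1" by (intro small[of n]) simp
        then show ?thesis using UV[OF False] GB[OF False] by (simp add: E_def algebra_simps)
      qed
      ultimately show ?thesis by (simp add: J_def)
    qed
    have "0 = (LINT x|lborel. m n x * J x) + (LINT x|lborel. B x * frechet_derivative (m n) (at x) (V x))
        + (LINT x|lborel. E n x)"
      using tr(2) I1 I2 E_int[of n] unfolding split by simp
    then show "(LINT x|lborel. m n x * J x) = - (LINT x|lborel. E n x)" by (simp add: flux_c)
  qed
  have "(\<lambda>n. LINT x|lborel. m n x * J x) \<longlonglongrightarrow> (LINT x|lborel. J x)"
  proof (rule integral_dominated_convergence[where w = "\<lambda>x. M\<mu> * \<bar>J x\<bar>"])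
    show "J \<in> borel_measurable lborel" using J_int by simp
    show "(\<lambda>x. m n x * J x) \<in> borel_measurable lborel" for n using mJ_int by simp
    show "integrable lborel (\<lambda>x. M\<mu> * \<bar>J x\<bar>)" using J_int by simp
    show "AE x in lborel. (\<lambda>n. m n x * J x) \<longlonglongrightarrow> J x"
      using AE_lborel_singleton[of "0 :: real^3"]
    proof eventually_elim
      case (elim x)
      from far[OF elim] have "\<forall>\<^sub>F n in sequentially. m n x * J x = J x"
        by eventually_elim (simp add: m1)
      then show ?case by (rule tendsto_eventually)
    qed
    show "AE x in lborel. norm (m n x * J x) \<le> M\<mu> * \<bar>J x\<bar>" for n
      using M\<mu> by (auto simp: m_def abs_mult intro!: mult_right_mono)
  qed
  moreover have "(\<lambda>n. LINT x|lborel. m n x * J x) \<longlonglongrightarrow> 0"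
    using tendsto_minus[OF E_lim] by (simp add: mJ)
  ultimately have "(LINT x|lborel. J x) = 0" by (rule LIMSEQ_unique)
  then show "integrable lborel (\<lambda>x. frechet_derivative G (at x) (U x))"
    "(LINT x|lborel. frechet_derivative G (at x) (U x)) = 0"
    using J_int by (simp_all add: J_def[abs_def])
qed

theorem mainTheorem12:
  fixes \<alpha> :: real
    and v \<psi> V \<Psi> Vbar F :: "real^3 \<Rightarrow> real^3"
    and f p h P Ptilde Q P0 Pbar :: "real^3 \<Rightarrow> real"
    and \<phi> \<eta> :: "real \<Rightarrow> real"
  assumes alpha: "\<alpha> = 2/3"
    \<comment> \<open>the homogeneous Euler solution\<close>
    and v: "smooth_on_sphere v" "tangent_to_sphere v"
    and f: "smooth_on_sphere f"
    and p: "smooth_on_sphere p"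
    and V: "V = radial_field (\<lambda>r. 1 / r powr \<alpha>) v f"
    and P: "P = (\<lambda>x. p (sgn x) / norm x powr (2 * \<alpha>))"
    and euler: "\<And>x. x \<noteq> 0 \<Longrightarrow> advect V x + grad P x = 0"
    and div_V: "\<And>x. x \<noteq> 0 \<Longrightarrow> diverg V x = 0"
    \<comment> \<open>the stream-field\<close>
    and psi: "smooth_on_sphere \<psi>" "tangent_to_sphere \<psi>"
    and h: "smooth_on_sphere h"
    and Psi: "\<Psi> = radial_field (\<lambda>r. r powr (1 - \<alpha>)) \<psi> h"
    and curl_Psi: "\<And>x. x \<noteq> 0 \<Longrightarrow> V x = curl \<Psi> x"
    and div_Psi: "\<And>x. x \<noteq> 0 \<Longrightarrow> diverg \<Psi> x = 0"
    \<comment> \<open>the tapered velocity and pressure, and the force\<close>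
    and phi: "smooth_on {0<..} \<phi>" "\<And>r. 0 < r \<Longrightarrow> r < 1 \<Longrightarrow> \<phi> r = r powr (1 - \<alpha>)"
      "\<And>r. r > 2 \<Longrightarrow> \<phi> r = 0"
    and chi: "smooth_on {0<..} \<eta>" "\<And>r. 0 < r \<Longrightarrow> r < 1 \<Longrightarrow> \<eta> r = 1"
      "\<And>r. r > 2 \<Longrightarrow> \<eta> r = 0"
    and Vbar: "Vbar = curl (radial_field \<phi> \<psi> h)"
    and Ptilde: "Ptilde = (\<lambda>x. \<eta> (norm x) * P x)"
    and Q: "Q = pressure_source Vbar Ptilde"
    and P0: "P0 = newtonian_convolution Q"
    and Pbar: "Pbar = (\<lambda>x. Ptilde x + P0 x)"
    and F: "F = (\<lambda>x. if 1 \<le> norm x \<and> norm x \<le> 2 then advect Vbar x + grad Pbar x else grad P0 x)"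
  shows "integrable lborel (\<lambda>x. F x \<bullet> Vbar x) \<and> (LINT x|lborel. F x \<bullet> Vbar x) = 0"
proof -
  let ?S = "- {0 :: real^3}"
  have opn: "open ?S" by auto
  have zoneS: "x \<in> ball 0 1 - {0} \<longleftrightarrow> x \<noteq> 0 \<and> norm x < 1" for x :: "real^3" by auto
  have opnI: "open (ball (0 :: real^3) 1 - {0})" by auto
  have opnO: "open {x :: real^3. 2 < norm x}" by (intro open_Collect_less continuous_intros)

  \<comment> \<open>Smoothness of the fields away from the origin\<close>
  have powr_smooth: "smooth_on {0<..} (\<lambda>r :: real. 1 / r powr a)" for a
    using smooth_on_powr[of "- a"] by (simp add: powr_minus_divide)
  have smV: "smooth_on ?S V" unfolding V by (intro smooth_on_radial_field powr_smooth v f)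
  have smP: "smooth_on ?S P"
  proof -
    have "smooth_on ?S (\<lambda>x. p (sgn x) * (1 / norm x powr (2 * \<alpha>)))"
      by (intro smooth_on_mult opn smooth_on_sphere_sgn p
          smooth_on_radial[of "\<lambda>r. 1 / r powr (2 * \<alpha>)"] powr_smooth)
    then show ?thesis by (simp add: P)
  qed
  have smPsibar: "smooth_on ?S (radial_field \<phi> \<psi> h)" by (intro smooth_on_radial_field phi psi h)
  have smU: "smooth_on ?S Vbar" unfolding Vbar by (intro smooth_on_curl opn smPsibar)
  have smPt: "smooth_on ?S Ptilde"
    unfolding Ptilde by (intro smooth_on_mult opn smP smooth_on_radial[OF chi(1)])
  have diff: "g differentiable (at x)" if "smooth_on ?S g" "x \<noteq> 0"
    for g :: "real^3 \<Rightarrow> 'b::real_normed_vector" and x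
    using smooth_on_has_derivative[OF that(1), of x] that(2) by (auto simp: differentiable_def)
  have divU: "diverg Vbar x = 0" if "x \<noteq> 0" for x
    unfolding Vbar by (rule diverg_curl[OF opn _ smPsibar]) (use that in simp)

  have curl_cong: "curl X x = curl Y x"
    if "open S" "x \<in> S" "\<And>y. y \<in> S \<Longrightarrow> X y = Y y" for S x and X Y :: "real^3 \<Rightarrow> real^3"
  proof -
    have "partial i (\<lambda>y. X y $ j) x = partial i (\<lambda>y. Y y $ j) x" for i j
      by (rule partial_cong_open[OF that(1,2)]) (simp add: that(3))
    then show ?thesis by (simp add: curl_def)
  qed
  have UV: "Vbar x = V x" if x: "x \<noteq> 0" "norm x < 1" for x
  proof -
    have "Vbar x = curl \<Psi> x" unfolding Vbar
    proof (rule curl_cong[OF opnI])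
      show "x \<in> ball 0 1 - {0}" using x by simp
      fix y :: "real^3" assume "y \<in> ball 0 1 - {0}"
      then show "radial_field \<phi> \<psi> h y = \<Psi> y" by (simp add: Psi radial_field_def phi(2))
    qed
    then show ?thesis using curl_Psi[OF x(1)] by simp
  qed
  have U0: "Vbar x = 0" if x: "2 < norm x" for x
  proof -
    have "Vbar x = curl (\<lambda>y. 0) x" unfolding Vbar
      by (rule curl_cong[OF opnO]) (use x in \<open>auto simp: radial_field_def phi(3)\<close>)
    also have "\<dots> = 0" by (simp add: curl_def partial_def vec_eq_iff forall_3 vector_3)
    finally show ?thesis .
  qed
  have PtP: "Ptilde x = P x" if "x \<noteq> 0" "norm x < 1" for x
    using that by (simp add: Ptilde chi(2))
  have Pt0: "Ptilde x = 0" if "2 < norm x" for x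
    using that by (simp add: Ptilde chi(3))

  \<comment> \<open>The Euler equations on either side of the tapering shell\<close>
  have advect_cong: "advect X x = advect Y x"
    if "open S" "x \<in> S" "\<And>y. y \<in> S \<Longrightarrow> X y = Y y" for S x and X Y :: "real^3 \<Rightarrow> real^3"
    by (simp add: advect_def partial_cong_open[OF that] that(2,3))
  have grad_cong: "grad g x = grad k x"
    if "open S" "x \<in> S" "\<And>y. y \<in> S \<Longrightarrow> g y = k y" for S x and g k :: "real^3 \<Rightarrow> real"
    by (simp add: grad_def partial_cong_open[OF that])
  have eulerI: "advect Vbar x + grad Ptilde x = 0" if x: "x \<in> ball 0 1 - {0}" for x
  proof -
    have "advect Vbar x = advect V x" by (rule advect_cong[OF opnI x]) (simp add: UV)
    moreover have "grad Ptilde x = grad P x" by (rule grad_cong[OF opnI x]) (simp add: PtP)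
    ultimately show ?thesis using euler[of x] x by simp
  qed
  have eulerO: "advect Vbar x + grad Ptilde x = 0" if x: "x \<in> {x. 2 < norm x}" for x
  proof -
    have "grad Ptilde x = grad (\<lambda>y. 0) x" by (rule grad_cong[OF opnO x]) (simp add: Pt0)
    also have "\<dots> = 0" by (simp add: grad_def partial_def vec_eq_iff)
    finally show ?thesis using U0[of x] x by (simp add: advect_def)
  qed

  \<comment> \<open>The source formula without its restriction to the shell. The Euler equations
    make it vanish in the punctured unit ball and beyond radius 2, so it coincides with
    \<open>Q\<close> off the origin, and the jumps that the case distinction in \<open>Q\<close>
    suggests do not occur.\<close>
  define q where "q x = - laplacian Ptilde x - div_div_tensor Vbar x" for x
  have smq: "smooth_on ?S q" unfolding q_def
    by (intro smooth_on_diff smooth_on_uminus smooth_on_laplacian smooth_on_div_div_tensor opn smPt smU)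
  have Qq: "Q x = q x" if "x \<noteq> 0" for x
  proof (cases "1 \<le> norm x \<and> norm x \<le> 2")
    case True
    then show ?thesis by (simp add: Q pressure_source_def q_def)
  next
    case False
    have "laplacian Ptilde x + div_div_tensor Vbar x = 0"
    proof (cases "norm x < 1")
      case True
      then have "x \<in> ball 0 1 - {0}" using that by simp
      then show ?thesis
        by (rule stationary_Euler_pressure_equation[OF opnI])
          (auto intro: smooth_on_subset[OF smU] smooth_on_subset[OF smPt] divU eulerI)
    next
      case far: False
      then have "x \<in> {x. 2 < norm x}" using False by auto
      then show ?thesis
        by (rule stationary_Euler_pressure_equation[OF opnO])
          (auto intro!: smooth_on_subset[OF smU] smooth_on_subset[OF smPt] divU eulerO)
    qed
    then show ?thesis using False by (auto simp: Q pressure_source_def q_def)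
  qed
  have "smooth_on UNIV Q"
  proof -
    have "smooth_on ?S Q" by (subst smooth_on_cong[OF opn, where g = q]) (use Qq smq in auto)
    \<comment> \<open>At the origin \<open>q\<close> is built from singular fields; there smoothness
      comes from \<open>Q\<close> being 0 on the open unit ball by definition.\<close>
    moreover have "smooth_on (ball 0 1) Q"
      by (subst smooth_on_cong[OF open_ball, where g = "\<lambda>x. 0"])
        (auto simp: Q pressure_source_def smooth_on_const)
    ultimately have "smooth_on (?S \<union> ball 0 1) Q" by (intro smooth_on_Un opn open_ball)
    moreover have "?S \<union> ball 0 1 = UNIV" by auto
    ultimately show ?thesis by simp
  qed
  then have P0_C1: "Ck_on (Suc 0) UNIV P0" unfolding P0 smooth_on_def
    by (intro Ck_on_newtonian_convolution[where R = 2]) (auto simp: Q pressure_source_def)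
  then have P0_diff: "P0 differentiable (at x)" for x by simp

  \<comment> \<open>Bernoulli functions of the homogeneous and of the tapered flow\<close>
  define B where "B x = V x \<bullet> V x / 2 + P x" for x
  define G where "G x = Vbar x \<bullet> Vbar x / 2 + Pbar x" for x
  have smB: "smooth_on ?S B"
  proof -
    have "smooth_on ?S (\<lambda>x. 1 / 2 * (V x \<bullet> V x) + P x)"
      by (intro smooth_on_add smooth_on_mult smooth_on_const smooth_on_inner opn smV smP)
    then show ?thesis by (simp add: B_def[abs_def])
  qed
  have C1G: "Ck_on (Suc 0) ?S G"
  proof -
    have "Ck_on (Suc 0) ?S (\<lambda>x. 1 / 2 * (Vbar x \<bullet> Vbar x) + (Ptilde x + P0 x))"
      using smU smPt unfolding smooth_on_def
      by (intro Ck_on_add Ck_on_mult Ck_on_const Ck_on_inner opn Ck_on_subset[OF P0_C1]) auto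
    then show ?thesis by (simp add: G_def[abs_def] Pbar)
  qed
  have Pbar_diff: "Pbar differentiable (at x)" if "x \<noteq> 0" for x
    unfolding Pbar using diff[OF smPt that] P0_diff by (rule differentiable_add)

  have homV: "V (c *\<^sub>R x) = c powr (- 2/3) *\<^sub>R V x" if "0 < c" for c x
    using that by (simp add: V radial_field_def alpha sgn_scaleR powr_mult powr_minus_divide)
  have homB: "B (c *\<^sub>R x) = c powr (- 4/3) * B x" if "0 < c" for c x
  proof -
    have "c powr (- 2/3) * c powr (- 2/3) = c powr (- 4/3)" by (simp flip: powr_add)
    then have "V (c *\<^sub>R x) \<bullet> V (c *\<^sub>R x) = c powr (- 4/3) * (V x \<bullet> V x)"
      by (simp add: homV[OF that] flip: mult.assoc)
    moreover have "P (c *\<^sub>R x) = c powr (- 4/3) * P x"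
      using that by (simp add: P alpha sgn_scaleR powr_mult powr_minus_divide)
    ultimately show ?thesis by (simp add: B_def algebra_simps)
  qed
  have transport: "frechet_derivative B (at x) (V x) = 0" if "x \<noteq> 0" for x
    unfolding B_def[abs_def]
    using frechet_derivative_Bernoulli[OF diff[OF smV that] diff[OF smP that]] euler[OF that] by simp

  \<comment> \<open>The pressure taper doubles as the cutoff. Its profile \<open>\<eta>\<close> is
    prescribed only for positive radii, so the value at the origin is set by hand to make
    \<open>\<mu>\<close> vanish on the whole unit ball.\<close>
  define \<mu> where "\<mu> x = (if x = 0 then 0 else 1 - \<eta> (norm x))" for x :: "real^3"
  have "smooth_on ?S (\<lambda>x. 1 - \<eta> (norm x))"
    by (intro smooth_on_diff smooth_on_const opn smooth_on_radial chi)
  then have "smooth_on ?S \<mu>" by (subst smooth_on_cong[OF opn]) (auto simp: \<mu>_def)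
  then have C1\<mu>: "Ck_on (Suc 0) ?S \<mu>" unfolding smooth_on_def by blast

  \<comment> \<open>The three cases of \<open>F\<close> agree once paired with \<open>Vbar\<close>:
    in the unit ball the Euler equations reduce the momentum expression to the gradient of
    \<open>P0\<close>, on the shell it is \<open>F\<close> by definition, and beyond radius 2 both
    sides vanish with \<open>Vbar\<close>.\<close>
  have FG: "F x \<bullet> Vbar x = frechet_derivative G (at x) (Vbar x)" if x: "x \<noteq> 0" for x
  proof -
    have G': "frechet_derivative G (at x) (Vbar x) = (advect Vbar x + grad Pbar x) \<bullet> Vbar x"
      unfolding G_def[abs_def] by (rule frechet_derivative_Bernoulli[OF diff[OF smU x] Pbar_diff[OF x]])
    consider "norm x < 1" | "1 \<le> norm x \<and> norm x \<le> 2" | "2 < norm x" by linarith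
    then show ?thesis
    proof cases
      case 1
      have "grad Pbar x = grad Ptilde x + grad P0 x"
      proof -
        have "((\<lambda>y. Ptilde y + P0 y) has_derivative (\<lambda>h. frechet_derivative Ptilde (at x) h +
            frechet_derivative P0 (at x) h)) (at x)"
          using diff[OF smPt x] P0_diff[of x]
          by (intro has_derivative_add) (auto simp: frechet_derivative_works)
        then show ?thesis by (simp add: Pbar grad_def vec_eq_iff partial_eqI) (simp add: partial_def)
      qed
      moreover have "advect Vbar x + grad Ptilde x = 0" using eulerI[of x] x 1 by simp
      ultimately have "advect Vbar x + grad Pbar x = grad P0 x" by (simp add: add.assoc[symmetric])
      then show ?thesis using 1 by (simp add: F G')
    next
      case 2
      then show ?thesis by (simp add: F G')
    next
      case 3
      then show ?thesis unfolding G' by (simp add: U0)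
    qed
  qed
  have "Ck_on (Suc 0) ?S V" "Ck_on (Suc 0) ?S B" "Ck_on (Suc 0) ?S Vbar"
    using smV smB smU unfolding smooth_on_def by blast+
  note C1 = this
  have J: "integrable lborel (\<lambda>x. frechet_derivative G (at x) (Vbar x))"
    "(LINT x|lborel. frechet_derivative G (at x) (Vbar x)) = 0"
    by (rule tapered_flux_eq_0[OF C1(1,2) homV homB div_V transport C1\<mu> _ _ C1(3) divU U0 UV P0_C1 C1G];
        auto simp: \<mu>_def chi(2,3) G_def B_def Pbar PtP UV)+
  have "continuous_on ?S (\<lambda>x. frechet_derivative G (at x) (Vbar x))"
    by (intro continuous_on_frechet_derivative_apply opn C1G Ck_on_imp_continuous_on[OF C1(3)])
  then have "continuous_on ?S (\<lambda>x. F x \<bullet> Vbar x)"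
    by (rule continuous_on_eq) (simp add: FG)
  then have meas: "(\<lambda>x. F x \<bullet> Vbar x) \<in> borel_measurable lborel"
    using borel_measurable_continuous_off_0 by simp
  \<comment> \<open>The identity is known only off the origin, a null set.\<close>
  have "AE x in lborel. frechet_derivative G (at x) (Vbar x) = F x \<bullet> Vbar x"
    using AE_lborel_singleton[of "0 :: real^3"] by eventually_elim (simp add: FG)
  then show ?thesis
    using integrable_cong_AE_imp[OF J(1) meas] integral_cong_AE[OF _ meas] J
    by (metis (mono_tags, lifting) AE_cong borel_measurable_integrable)
qed

end
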